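(* Let $\Omega\subsetneq\mathbb{C}^n$ be a $B$-regular domain, and let $f\in\mathcal{C}(\overline\Omega;\mathbb{R})$ be a non-negative function. Let $\varphi:\mathcal{U}\to\mathbb{R}$ be a $\mathcal{C}^\infty$-smooth function, where $\mathcal{U}$ is a neighbourhood of $\overline\Omega$. Assume that $\varphi$ is plurisubharmonic on $\mathcal{U}$ and that there exists a constant $\varepsilon>0$ such that $\langle v,(\mathfrak{H}_{\mathbb{C}}\varphi)(z)v\rangle\geq\varepsilon\|v\|^2$ for every $z\in\Omega$ and $v\in\mathbb{C}^n$. Let $\omega_{f,\varphi}$ be a modulus of continuity of the unique solution to the Dirichlet problem $$(dd^cu)^n=f\beta_n,\quad u\in\mathcal{C}(\overline\Omega)\cap\mathsf{psh}(\Omega),\qquad u|_{\partial\Omega}=-2\varphi|_{\partial\Omega},$$ for the complex Monge–Ampère equation. Then there exists a constant $c>0$ such that $$k_\Omega(z;v)\geq c\,\sqrt{\varepsilon}\,\frac{\|v\|}{\big(\omega_{f,\varphi}(\delta_\Omega(z))\big)^{1/2}}$$ for every $z\in\Omega$ and $v\in\mathbb{C}^n$.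
   Context: $B$-regular: a bounded domain $\Omega\subset\mathbb{C}^n$ is $B$-regular if every $g\in\mathcal{C}(\partial\Omega;\mathbb{R})$ is the uniform limit on $\partial\Omega$ of a sequence $(u_\nu)_{\nu\ge1}$ of continuous plurisubharmonic functions defined on open neighbourhoods of $\partial\Omega$ (each neighbourhood depending on $u_\nu$). $\mathcal{C}(\overline\Omega)\cap\mathsf{psh}(\Omega)$ is the class of continuous functions $u:\overline\Omega\to\mathbb{R}$ with $u|_\Omega$ plurisubharmonic. $(dd^cu)^n$ is the complex Monge–Ampère operator, i.e. the $n$-fold wedge product $dd^cu\wedge\dots\wedge dd^cu$, understood as a current of bidegree $(n,n)$ in the sense of Bedford–Taylor, with the normalisation $dd^cu=\frac i2\sum_{j,k}\frac{\partial^2u}{\partial z_j\partial\bar z_k}dz_j\wedge d\bar z_k$, and $\beta_n:=(i/2)^n(dz_1\wedge d\bar z_1)\wedge\dots\wedge(dz_n\wedge d\bar z_n)$. It is a known theorem (Błocki) that, on a $B$-regular domain, the Dirichlet problem $(dd^cu)^n=f\beta_n$, $u|_{\partial\Omega}=g$, $u\in\mathcal{C}(\overline\Omega)\cap\mathsf{psh}(\Omega)$, has a unique solution for every non-negative $f\in\mathcal{C}(\overline\Omega;\mathbb{R})$ and every $g\in\mathcal{C}(\partial\Omega;\mathbb{R})$. A modulus of continuity of a function $u$ on $\overline\Omega$ is a monotone increasing function $\omega:[0,\infty)\to[0,\infty)$ with $\lim_{r\to0^+}\omega(r)=\omega(0)=0$ and $|u(x)-u(y)|\leq\omega(\|x-y\|)$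 for all $x,y\in\overline\Omega$. $\mathfrak{H}_{\mathbb{C}}\varphi$ is the complex Hessian of $\varphi$ and $\langle\cdot,\cdot\rangle$ the standard Hermitian inner product on $\mathbb{C}^n$; thus $\langle v,(\mathfrak{H}_{\mathbb{C}}\varphi)(z)v\rangle$ is the Levi form $\sum_{j,k}\frac{\partial^2\varphi}{\partial z_j\partial\bar z_k}(z)v_j\bar v_k$. $\|\cdot\|$ is the Euclidean norm and $\delta_\Omega(z):=\inf\{\|z-\xi\|:\xi\in\partial\Omega\}$. $k_\Omega$ is the Kobayashi metric: $k_\Omega(z;v)=\inf\{|a|: a\in\mathbb{C},\ \exists\,g:\mathbb{D}\to\Omega\text{ holomorphic with }g(0)=z,\ a\,g'(0)=v\}$, with $\mathbb{D}$ the open unit disc.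
   Formalization: If the solution u is constant, the modulus of continuity is additionally assumed to satisfy ω(r) ≥ a r for some a > 0 and all small r > 0; without this the claim fails (unit disc, φ = |z|² − 1, f = 0, u = 0, ω(r) = r¹⁰). *)

theory Defs
  imports "HOL-Complex_Analysis.Complex_Analysis"
begin

text \<open>Throughout, \<open>complex ^ 'n\<close> is $\mathbb C^n$ with $n =$ \<open>CARD('n)\<close>; its norm is the
  Euclidean norm, and \<open>lborel\<close> is Lebesgue measure on the underlying $\mathbb R^{2n}$, i.e. the
  measure given by the volume form $\beta_n$.\<close>

subsection \<open>Smooth functions and Wirtinger derivatives\<close>

text \<open>For open \<open>S\<close>: all iterated directional derivatives of order up to \<open>k\<close> exist and are
  continuous.\<close>

primrec Ck_on ::
    "nat \<Rightarrow> 'a::real_normed_vector set \<Rightarrow> ('a \<Rightarrow> 'b::real_normed_vector) \<Rightarrow> bool" where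
  "Ck_on 0 S F \<longleftrightarrow> continuous_on S F"
| "Ck_on (Suc k) S F \<longleftrightarrow>
     F differentiable_on S \<and> (\<forall>v. Ck_on k S (\<lambda>x. frechet_derivative F (at x) v))"

definition smooth_on ::
    "'a::real_normed_vector set \<Rightarrow> ('a \<Rightarrow> 'b::real_normed_vector) \<Rightarrow> bool" where
  "smooth_on S F \<longleftrightarrow> (\<forall>k. Ck_on k S F)"

text \<open>$\partial/\partial z_j = \frac12(\partial/\partial x_j - i\,\partial/\partial y_j)$ and
  $\partial/\partial \bar z_j = \frac12(\partial/\partial x_j + i\,\partial/\partial y_j)$.\<close>

definition dz :: "'n::finite \<Rightarrow> (complex ^ 'n \<Rightarrow> complex) \<Rightarrow> complex ^ 'n \<Rightarrow> complex" where
  "dz j F z = (frechet_derivative F (at z) (axis j 1)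
                - \<i> * frechet_derivative F (at z) (axis j \<i>)) / 2"

definition dzbar :: "'n::finite \<Rightarrow> (complex ^ 'n \<Rightarrow> complex) \<Rightarrow> complex ^ 'n \<Rightarrow> complex" where
  "dzbar j F z = (frechet_derivative F (at z) (axis j 1)
                   + \<i> * frechet_derivative F (at z) (axis j \<i>)) / 2"

definition complex_hessian ::
    "(complex ^ 'n::finite \<Rightarrow> real) \<Rightarrow> complex ^ 'n \<Rightarrow> complex ^ 'n ^ 'n" where
  "complex_hessian \<phi> z = (\<chi> j k. dz j (dzbar k (\<lambda>w. of_real (\<phi> w))) z)"

text \<open>$\langle v, (\mathfrak H_{\mathbb C}\varphi)(z) v\rangle$, which is real for \<open>\<phi>\<close> of class
  $C^2$.\<close>

definition levi_form ::
    "(complex ^ 'n::finite \<Rightarrow> real) \<Rightarrow> complex ^ 'n \<Rightarrow> complex ^ 'n \<Rightarrow> complex" where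
  "levi_form \<phi> z v =
     (\<Sum>j\<in>UNIV. \<Sum>k\<in>UNIV. complex_hessian \<phi> z $ j $ k * v $ j * cnj (v $ k))"

subsection \<open>Plurisubharmonic functions and B-regular domains\<close>

text \<open>Continuous real-valued plurisubharmonic functions on an open set \<open>S\<close>; for these the upper
  semicontinuity in the general definition is automatic. The second clause is the sub-mean value
  inequality on every closed disc of a complex line contained in \<open>S\<close>.\<close>

definition cont_psh_on :: "(complex ^ 'n::finite) set \<Rightarrow> (complex ^ 'n \<Rightarrow> real) \<Rightarrow> bool" where
  "cont_psh_on S u \<longleftrightarrow> continuous_on S u \<and>
     (\<forall>a b. (\<forall>\<zeta>\<in>cball 0 1. a + \<zeta> *s b \<in> S) \<longrightarrow>
        u a \<le> 1 / (2 * pi) * integral {0..2 * pi} (\<lambda>t. u (a + cis t *s b)))"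

definition B_regular_domain :: "(complex ^ 'n::finite) set \<Rightarrow> bool" where
  "B_regular_domain \<Omega> \<longleftrightarrow>
     open \<Omega> \<and> connected \<Omega> \<and> \<Omega> \<noteq> {} \<and> bounded \<Omega> \<and>
     (\<forall>g :: complex ^ 'n \<Rightarrow> real. continuous_on (frontier \<Omega>) g \<longrightarrow>
        (\<exists>(V :: nat \<Rightarrow> (complex ^ 'n) set) (w :: nat \<Rightarrow> complex ^ 'n \<Rightarrow> real).
           (\<forall>\<nu>. open (V \<nu>) \<and> frontier \<Omega> \<subseteq> V \<nu> \<and> cont_psh_on (V \<nu>) (w \<nu>)) \<and>
           uniform_limit (frontier \<Omega>) w g sequentially))"

subsection \<open>The complex Monge--Ampere operator\<close>

text \<open>Continuous functions on $\mathbb C^n$ with compact support in \<open>\<Omega>\<close>.\<close>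

definition Cc :: "(complex ^ 'n::finite) set \<Rightarrow> (complex ^ 'n \<Rightarrow> complex) set" where
  "Cc \<Omega> = {\<psi>. continuous_on UNIV \<psi> \<and> compact (closure {z. \<psi> z \<noteq> 0}) \<and> closure {z. \<psi> z \<noteq> 0} \<subseteq> \<Omega>}"

text \<open>Distributions of order 0 on \<open>\<Omega>\<close>, i.e. complex Radon measures, as functionals on
  \<open>Cc \<Omega>\<close>; values outside \<open>Cc \<Omega>\<close> are irrelevant.\<close>

definition order0_distribution ::
    "(complex ^ 'n::finite) set \<Rightarrow> ((complex ^ 'n \<Rightarrow> complex) \<Rightarrow> complex) \<Rightarrow> bool" where
  "order0_distribution \<Omega> T \<longleftrightarrow>
     (\<forall>\<psi>\<in>Cc \<Omega>. \<forall>\<eta>\<in>Cc \<Omega>. T (\<lambda>z. \<psi> z + \<eta> z) = T \<psi> + T \<eta>) \<and>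
     (\<forall>\<psi>\<in>Cc \<Omega>. \<forall>c. T (\<lambda>z. c * \<psi> z) = c * T \<psi>) \<and>
     (\<forall>K. compact K \<and> K \<subseteq> \<Omega> \<longrightarrow>
        (\<exists>C. \<forall>\<psi>\<in>Cc \<Omega>. \<forall>B. {z. \<psi> z \<noteq> 0} \<subseteq> K \<and> (\<forall>z. norm (\<psi> z) \<le> B) \<longrightarrow> norm (T \<psi>) \<le> C * B))"

text \<open>A current of bidegree $(k,k)$ is represented by its coefficients \<open>T J L\<close>, indexed by lists
  \<open>J\<close>, \<open>L\<close> of length \<open>k\<close> and alternating in each of \<open>J\<close> and \<open>L\<close>:
  \[ T = \Big(\frac i2\Big)^{k} \frac1{(k!)^2} \sum_{|J| = |L| = k} T_{J,L}\,
       dz_{j_1}\wedge d\bar z_{l_1}\wedge\dots\wedge dz_{j_k}\wedge d\bar z_{l_k}. \]\<close>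

type_synonym 'n current =
  "'n list \<Rightarrow> 'n list \<Rightarrow> (complex ^ 'n \<Rightarrow> complex) \<Rightarrow> complex"

definition delete_nth :: "nat \<Rightarrow> 'a list \<Rightarrow> 'a list" where
  "delete_nth a xs = take a xs @ drop (Suc a) xs"

text \<open>The Bedford--Taylor product: \<open>T\<close> is $dd^c u\wedge S := dd^c(uS)$ for a current \<open>S\<close> of
  bidegree $(k,k)$ with order 0 coefficients, with
  $dd^c = \frac i2\sum_{j,l}\frac{\partial^2}{\partial z_j\partial\bar z_l}\,dz_j\wedge d\bar z_l\wedge$
  in the sense of distributions. In alternating coefficients this reads
  $T_{J,L} = \sum_{a,b}(-1)^{a+b}\,\frac{\partial^2}{\partial z_{j_a}\partial\bar z_{l_b}}
    (u\,S_{J\setminus j_a,\,L\setminus l_b})$. The distribution on the right is required to have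
  order 0, so that it extends uniquely to \<open>Cc \<Omega>\<close> and the product can be iterated.\<close>

definition is_ddc_wedge ::
    "(complex ^ 'n::finite) set \<Rightarrow> (complex ^ 'n \<Rightarrow> real) \<Rightarrow> nat \<Rightarrow> 'n current \<Rightarrow> 'n current \<Rightarrow> bool"
  where
  "is_ddc_wedge \<Omega> u k S T \<longleftrightarrow>
     (\<forall>J L. length J = Suc k \<and> length L = Suc k \<longrightarrow>
        order0_distribution \<Omega> (T J L) \<and>
        (\<forall>\<psi>\<in>Cc \<Omega>. smooth_on UNIV \<psi> \<longrightarrow>
           T J L \<psi> = (\<Sum>a\<le>k. \<Sum>b\<le>k. (-1) ^ (a + b) *
             S (delete_nth a J) (delete_nth b L)
               (\<lambda>z. of_real (u z) * dz (J ! a) (dzbar (L ! b) \<psi>) z))))"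

text \<open>\<open>T\<close> is the \<open>k\<close>-fold product $dd^c u\wedge\dots\wedge dd^c u$ on \<open>\<Omega>\<close>; the empty product is the
  constant function 1.\<close>

primrec is_ddc_power ::
    "(complex ^ 'n::finite) set \<Rightarrow> (complex ^ 'n \<Rightarrow> real) \<Rightarrow> nat \<Rightarrow> 'n current \<Rightarrow> bool" where
  "is_ddc_power \<Omega> u 0 T \<longleftrightarrow> (\<forall>\<psi>\<in>Cc \<Omega>. T [] [] \<psi> = integral\<^sup>L lborel \<psi>)"
| "is_ddc_power \<Omega> u (Suc k) T \<longleftrightarrow> (\<exists>S. is_ddc_power \<Omega> u k S \<and> is_ddc_wedge \<Omega> u k S T)"

text \<open>$(dd^c u)^n = f\beta_n$ on \<open>\<Omega>\<close>. An $(n,n)$-current is \<open>T J J\<close>$\,\beta_n$ for any enumeration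
  \<open>J\<close> of the coordinates.\<close>

definition monge_ampere_eq ::
    "(complex ^ 'n::finite) set \<Rightarrow> (complex ^ 'n \<Rightarrow> real) \<Rightarrow> (complex ^ 'n \<Rightarrow> real) \<Rightarrow> bool" where
  "monge_ampere_eq \<Omega> u f \<longleftrightarrow>
     (\<exists>T. is_ddc_power \<Omega> u CARD('n) T \<and>
        (\<forall>J. distinct J \<and> length J = CARD('n) \<longrightarrow>
           (\<forall>\<psi>\<in>Cc \<Omega>. T J J \<psi> = integral\<^sup>L lborel (\<lambda>z. of_real (f z) * \<psi> z))))"

definition solves_dirichlet ::
    "(complex ^ 'n::finite) set \<Rightarrow> (complex ^ 'n \<Rightarrow> real) \<Rightarrow> (complex ^ 'n \<Rightarrow> real) \<Rightarrow>
     (complex ^ 'n \<Rightarrow> real) \<Rightarrow> bool" where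
  "solves_dirichlet \<Omega> f g u \<longleftrightarrow>
     continuous_on (closure \<Omega>) u \<and> cont_psh_on \<Omega> u \<and> monge_ampere_eq \<Omega> u f \<and>
     (\<forall>\<xi>\<in>frontier \<Omega>. u \<xi> = g \<xi>)"

subsection \<open>Moduli of continuity and the Kobayashi metric\<close>

definition modulus_of_continuity_on ::
    "'a::metric_space set \<Rightarrow> ('a \<Rightarrow> real) \<Rightarrow> (real \<Rightarrow> real) \<Rightarrow> bool" where
  "modulus_of_continuity_on S u \<omega> \<longleftrightarrow>
     mono_on {0..} \<omega> \<and> (\<forall>r\<ge>0. \<omega> r \<ge> 0) \<and> \<omega> 0 = 0 \<and> (\<omega> \<longlongrightarrow> 0) (at_right 0) \<and>
     (\<forall>x\<in>S. \<forall>y\<in>S. \<bar>u x - u y\<bar> \<le> \<omega> (dist x y))"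

definition kobayashi_metric ::
    "(complex ^ 'n::finite) set \<Rightarrow> complex ^ 'n \<Rightarrow> complex ^ 'n \<Rightarrow> real" where
  "kobayashi_metric \<Omega> z v =
     Inf {norm a | a :: complex. \<exists>g :: complex \<Rightarrow> complex ^ 'n.
        (\<forall>i. (\<lambda>\<zeta>. g \<zeta> $ i) holomorphic_on ball 0 1) \<and> g ` ball 0 1 \<subseteq> \<Omega> \<and> g 0 = z \<and>
        a *s (\<chi> i. deriv (\<lambda>\<zeta>. g \<zeta> $ i) 0) = v}"

end

theory Submission
  imports Defs
begin

text \<open>Put $\rho = u + 2\varphi$. It is plurisubharmonic and vanishes on $\partial\Omega$, so
  $\rho \le 0$ by the maximum principle, and $\rho - 2\varepsilon\|z\|^2$ is still plurisubharmonic.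
  Composing the latter with a holomorphic disc $g$ and averaging over the circle of radius
  $r < 1$ gives
  $\rho(g(0)) - 2\varepsilon\|g(0)\|^2 \le -2\varepsilon(\|g(0)\|^2 + r^2\|g'(0)\|^2)$, that is,
  $2\varepsilon\|g'(0)\|^2 \le -\rho(g(0))$ after letting $r \to 1$. Comparing with a nearest boundary
  point, $-\rho(z) \le \omega(\delta) + 2L\delta$ with $\delta = \delta_\Omega(z)$ and $L$ a bound for
  $\|d\varphi\|$; the linear term is absorbed because the modulus of continuity of a non-constant
  function satisfies $\omega(r) \ge a r$ for small $r$.\<close>

no_notation fps_nth (infixl "$" 75)

subsection \<open>Means over the unit circle\<close>

text \<open>\<open>u\<close> is merely continuous and plurisubharmonicity is given only by integrals
  over affine discs, so \<open>\<rho>\<close> cannot be differentiated along a disc. The Levi bound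
  is therefore spent on the smooth \<open>\<phi>\<close> alone, by subtracting
  \<open>\<epsilon>\<close> times the squared norm, and \<open>u\<close> is added afterwards at the
  level of sub-mean inequalities. The two hard sub-mean inequalities (for \<open>\<phi>\<close>
  minus the quadratic term, and for a plurisubharmonic function along a holomorphic disc) are proved
  by one scheme. Continuous functions on the circle are uniform limits of real parts of polynomials,
  so it suffices to compare with real parts of entire functions. If the comparison fails at the
  centre, adding a small multiple of the squared modulus still leaves a maximum in the open disc,
  and there the added square gains a definite multiple of t^2 over circles of radius t. For
  \<open>\<phi>\<close> the contradiction is the second derivative test, for \<open>u\<close> it is
  the affine sub-mean inequality at the maximum point.\<close>

definition circle_mean :: "(complex \<Rightarrow> real) \<Rightarrow> real" where
  "circle_mean h = 1 / (2 * pi) * integral {0..2 * pi} (\<lambda>t. h (cis t))"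

lemma integrable_on_circle:
  assumes "continuous_on (sphere 0 1) (h :: complex \<Rightarrow> real)"
  shows "(\<lambda>t. h (cis t)) integrable_on {0..2 * pi}"
proof (rule integrable_continuous_real)
  show "continuous_on {0..2 * pi} (\<lambda>t. h (cis t))"
    by (rule continuous_on_compose2[OF assms]) (auto intro!: continuous_intros)
qed

lemma circle_mean_cong:
  assumes "\<And>\<zeta>. norm \<zeta> = 1 \<Longrightarrow> h \<zeta> = k \<zeta>"
  shows "circle_mean h = circle_mean k"
  using assms by (simp add: circle_mean_def)

lemma circle_mean_const [simp]: "circle_mean (\<lambda>_. c) = c"
  by (simp add: circle_mean_def)

lemma circle_mean_add:
  assumes "continuous_on (sphere 0 1) h" "continuous_on (sphere 0 1) k"
  shows "circle_mean (\<lambda>\<zeta>. h \<zeta> + k \<zeta>) = circle_mean h + circle_mean k"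
  using integrable_on_circle[OF assms(1)] integrable_on_circle[OF assms(2)]
  by (simp add: circle_mean_def integral_add algebra_simps)

lemma circle_mean_cmult: "circle_mean (\<lambda>\<zeta>. c * h \<zeta>) = c * circle_mean h"
  by (simp add: circle_mean_def)

lemma circle_mean_diff:
  assumes "continuous_on (sphere 0 1) h" "continuous_on (sphere 0 1) k"
  shows "circle_mean (\<lambda>\<zeta>. h \<zeta> - k \<zeta>) = circle_mean h - circle_mean k"
  using integrable_on_circle[OF assms(1)] integrable_on_circle[OF assms(2)]
  by (simp add: circle_mean_def integral_diff algebra_simps)

lemma circle_mean_sum:
  assumes "finite I" "\<And>i. i \<in> I \<Longrightarrow> continuous_on (sphere 0 1) (h i)"
  shows "circle_mean (\<lambda>\<zeta>. \<Sum>i\<in>I. h i \<zeta>) = (\<Sum>i\<in>I. circle_mean (h i))"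
  using assms integrable_on_circle
  by (simp add: circle_mean_def integral_sum sum_distrib_left)

lemma circle_mean_mono:
  assumes "continuous_on (sphere 0 1) h" "continuous_on (sphere 0 1) k"
    and "\<And>\<zeta>. norm \<zeta> = 1 \<Longrightarrow> h \<zeta> \<le> k \<zeta>"
  shows "circle_mean h \<le> circle_mean k"
  using integrable_on_circle[OF assms(1)] integrable_on_circle[OF assms(2)] assms(3)
  unfolding circle_mean_def by (intro mult_left_mono integral_le) auto

lemma circle_mean_Re_holomorphic:
  assumes "f holomorphic_on ball 0 R" "R > 1"
  shows "circle_mean (\<lambda>\<zeta>. Re (f \<zeta>)) = Re (f 0)"
proof -
  have "((\<lambda>u. f u / (u - 0)) has_contour_integral 2 * of_real pi * \<i> * f 0) (circlepath 0 1)"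
    by (rule Cauchy_integral_circlepath_simple)
      (use assms in \<open>auto intro: holomorphic_on_subset\<close>)
  then have "((\<lambda>t. f (cis t) / cis t * \<i> * cis t) has_integral 2 * of_real pi * \<i> * f 0) {0..2 * pi}"
    by (simp add: circlepath_def has_contour_integral_part_circlepath_iff)
  \<comment> \<open>Parametrising the circle brings in the factor \<open>\<i>\<close>, which this
    multiplication cancels on both sides.\<close>
  then have "((\<lambda>t. (f (cis t) / cis t * \<i> * cis t) * (- \<i>)) has_integral
      (2 * of_real pi * \<i> * f 0) * (- \<i>)) {0..2 * pi}"
    by (rule has_integral_mult_left)
  then have "((\<lambda>t. f (cis t)) has_integral of_real (2 * pi) * f 0) {0..2 * pi}"
    by (simp add: field_simps)
  from has_integral_Re[OF this] show ?thesis
    by (simp add: circle_mean_def integral_unique)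
qed

text \<open>Pythagoras for circle means: the cross term is the real part of a holomorphic function
  vanishing at 0, so its mean is 0. This identity carries all the means of squared norms
  below.\<close>

lemma circle_mean_cnorm_sq:
  assumes "E holomorphic_on ball 0 R" "R > 1"
  shows "circle_mean (\<lambda>\<zeta>. (norm (E \<zeta>))\<^sup>2)
    = (norm (E 0))\<^sup>2 + circle_mean (\<lambda>\<zeta>. (norm (E \<zeta> - E 0))\<^sup>2)"
proof -
  have cont: "continuous_on (sphere 0 1) E"
    using assms by (intro holomorphic_on_imp_continuous_on holomorphic_on_subset[OF assms(1)]) auto
  define k where "k = (\<lambda>\<zeta>. 2 * cnj (E 0) * (E \<zeta> - E 0))"
  have contk: "continuous_on (sphere 0 1) k"
    unfolding k_def by (intro continuous_intros cont)
  have k: "circle_mean (\<lambda>\<zeta>. Re (k \<zeta>)) = Re (k 0)"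
    by (rule circle_mean_Re_holomorphic[OF _ assms(2)])
      (auto simp: k_def intro!: holomorphic_intros assms)
  have "(norm (E \<zeta>))\<^sup>2 = ((norm (E 0))\<^sup>2 + Re (k \<zeta>)) + (norm (E \<zeta> - E 0))\<^sup>2" for \<zeta>
    unfolding cmod_power2 k_def by (simp add: algebra_simps power2_eq_square)
  then have "circle_mean (\<lambda>\<zeta>. (norm (E \<zeta>))\<^sup>2) =
      circle_mean (\<lambda>\<zeta>. ((norm (E 0))\<^sup>2 + Re (k \<zeta>)) + (norm (E \<zeta> - E 0))\<^sup>2)"
    by (intro circle_mean_cong)
  also have "\<dots> = circle_mean (\<lambda>\<zeta>. (norm (E 0))\<^sup>2 + Re (k \<zeta>)) + circle_mean (\<lambda>\<zeta>. (norm (E \<zeta> - E 0))\<^sup>2)"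
    by (intro circle_mean_add continuous_intros cont contk)
  also have "circle_mean (\<lambda>\<zeta>. (norm (E 0))\<^sup>2 + Re (k \<zeta>)) = (norm (E 0))\<^sup>2 + Re (k 0)"
    using circle_mean_add[OF continuous_on_const, of "\<lambda>\<zeta>. Re (k \<zeta>)" "(norm (E 0))\<^sup>2"] contk k
    by (auto intro!: continuous_intros)
  finally show ?thesis by (simp add: k_def)
qed

lemma norm_vec_sq: "(norm (x :: complex ^ 'n::finite))\<^sup>2 = (\<Sum>i\<in>UNIV. (norm (x $ i))\<^sup>2)"
  by (simp add: norm_vec_def L2_set_def sum_nonneg)

lemma circle_mean_norm_sq:
  fixes E :: "complex \<Rightarrow> complex ^ 'n::finite"
  assumes "\<And>i. (\<lambda>\<zeta>. E \<zeta> $ i) holomorphic_on ball 0 R" "R > 1"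
  shows "circle_mean (\<lambda>\<zeta>. (norm (E \<zeta>))\<^sup>2)
    = (norm (E 0))\<^sup>2 + circle_mean (\<lambda>\<zeta>. (norm (E \<zeta> - E 0))\<^sup>2)"
proof -
  have cont: "continuous_on (sphere 0 1) (\<lambda>\<zeta>. E \<zeta> $ i)" for i
    using assms by (intro holomorphic_on_imp_continuous_on holomorphic_on_subset[OF assms(1)]) auto
  have "circle_mean (\<lambda>\<zeta>. \<Sum>i\<in>UNIV. (norm (E \<zeta> $ i))\<^sup>2) = (\<Sum>i\<in>UNIV. circle_mean (\<lambda>\<zeta>. (norm (E \<zeta> $ i))\<^sup>2))"
    by (intro circle_mean_sum finite continuous_intros cont)
  also have "\<dots> = (\<Sum>i\<in>UNIV. (norm (E 0 $ i))\<^sup>2 + circle_mean (\<lambda>\<zeta>. (norm (E \<zeta> $ i - E 0 $ i))\<^sup>2))"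
    by (intro sum.cong refl circle_mean_cnorm_sq[OF assms])
  also have "\<dots> = (\<Sum>i\<in>UNIV. (norm (E 0 $ i))\<^sup>2)
      + circle_mean (\<lambda>\<zeta>. \<Sum>i\<in>UNIV. (norm (E \<zeta> $ i - E 0 $ i))\<^sup>2)"
    unfolding sum.distrib
    by (subst circle_mean_sum) (auto intro!: continuous_intros cont)
  finally show ?thesis by (simp add: norm_vec_sq)
qed

section \<open>Density of real parts of polynomials on the unit circle\<close>

inductive harmonic_poly :: "(complex \<Rightarrow> real) \<Rightarrow> bool" where
  monom: "harmonic_poly (\<lambda>\<zeta>. Re (c * \<zeta> ^ k))"
| add: "harmonic_poly f \<Longrightarrow> harmonic_poly g \<Longrightarrow> harmonic_poly (\<lambda>\<zeta>. f \<zeta> + g \<zeta>)"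

lemma harmonic_poly_eq_Re:
  assumes "harmonic_poly f"
  obtains P where "P holomorphic_on UNIV" "f = (\<lambda>\<zeta>. Re (P \<zeta>))"
proof -
  have "\<exists>P. P holomorphic_on UNIV \<and> f = (\<lambda>\<zeta>. Re (P \<zeta>))"
    using assms
  proof induction
    case (monom c k)
    then show ?case by (intro exI[of _ "\<lambda>\<zeta>. c * \<zeta> ^ k"]) (auto intro!: holomorphic_intros)
  next
    case (add f g)
    then obtain P Q where "P holomorphic_on UNIV" "f = (\<lambda>\<zeta>. Re (P \<zeta>))"
      "Q holomorphic_on UNIV" "g = (\<lambda>\<zeta>. Re (Q \<zeta>))" by blast
    then show ?case by (intro exI[of _ "\<lambda>\<zeta>. P \<zeta> + Q \<zeta>"]) (auto intro!: holomorphic_intros)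
  qed
  then show thesis using that by blast
qed

text \<open>Re a Re b is half of Re (a b) + Re (a cnj b), and on the circle cnj \<zeta> is the
  inverse of \<zeta>, so the second term is again a monomial, of exponent k - l. Natural exponents
  require l \<le> k; the other case follows by exchanging the factors.\<close>

lemma harmonic_poly_mult_monom:
  shows "\<exists>h. harmonic_poly h \<and> (\<forall>\<zeta>\<in>sphere 0 1. h \<zeta> = Re (c * \<zeta> ^ k) * Re (d * \<zeta> ^ l))"
proof -
  have prod: "Re a * Re b = Re (a * b / 2) + Re (a * cnj b / 2)" for a b
    by (simp add: field_simps)
  have *: "\<exists>h. harmonic_poly h \<and> (\<forall>\<zeta>\<in>sphere 0 1. h \<zeta> = Re (c * \<zeta> ^ k) * Re (d * \<zeta> ^ l))"
    if "l \<le> k" for c d k l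
  proof (intro exI conjI ballI)
    show "harmonic_poly (\<lambda>\<zeta>. Re ((c * d / 2) * \<zeta> ^ (k + l)) + Re ((c * cnj d / 2) * \<zeta> ^ (k - l)))"
      by (intro harmonic_poly.intros)
    fix \<zeta> :: complex assume "\<zeta> \<in> sphere 0 1"
    then have 1: "\<zeta> * cnj \<zeta> = 1" by (simp add: complex_norm_square[symmetric])
    have "\<zeta> ^ k * cnj \<zeta> ^ l = \<zeta> ^ (k - l) * (\<zeta> * cnj \<zeta>) ^ l"
      using that by (simp add: power_mult_distrib flip: power_add mult.assoc)
    then have "\<zeta> ^ k * cnj \<zeta> ^ l = \<zeta> ^ (k - l)" using 1 by simp
    moreover have "c * \<zeta> ^ k * cnj (d * \<zeta> ^ l) / 2 = (c * cnj d / 2) * (\<zeta> ^ k * cnj \<zeta> ^ l)"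
      by simp
    moreover have "c * \<zeta> ^ k * (d * \<zeta> ^ l) / 2 = (c * d / 2) * \<zeta> ^ (k + l)"
      by (simp add: power_add)
    ultimately show "Re ((c * d / 2) * \<zeta> ^ (k + l)) + Re ((c * cnj d / 2) * \<zeta> ^ (k - l))
        = Re (c * \<zeta> ^ k) * Re (d * \<zeta> ^ l)"
      by (simp only: prod)
  qed
  show ?thesis
    using *[of l k c d] *[of k l d c] by (cases "l \<le> k") (auto simp: mult.commute)
qed

lemma harmonic_poly_mult:
  assumes "harmonic_poly f" "harmonic_poly g"
  shows "\<exists>h. harmonic_poly h \<and> (\<forall>\<zeta>\<in>sphere 0 1. h \<zeta> = f \<zeta> * g \<zeta>)"
  using assms(1)
proof induction
  case (monom c k)
  show ?case using assms(2)
  proof induction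
    case (monom d l)
    show ?case by (rule harmonic_poly_mult_monom)
  next
    case (add g1 g2)
    then obtain h1 h2 where "harmonic_poly h1" "\<forall>\<zeta>\<in>sphere 0 1. h1 \<zeta> = Re (c * \<zeta> ^ k) * g1 \<zeta>"
      "harmonic_poly h2" "\<forall>\<zeta>\<in>sphere 0 1. h2 \<zeta> = Re (c * \<zeta> ^ k) * g2 \<zeta>" by blast
    then show ?case
      by (intro exI[of _ "\<lambda>\<zeta>. h1 \<zeta> + h2 \<zeta>"]) (auto simp: ring_distribs intro: harmonic_poly.add)
  qed
next
  case (add f1 f2)
  then obtain h1 h2 where "harmonic_poly h1" "\<forall>\<zeta>\<in>sphere 0 1. h1 \<zeta> = f1 \<zeta> * g \<zeta>"
    "harmonic_poly h2" "\<forall>\<zeta>\<in>sphere 0 1. h2 \<zeta> = f2 \<zeta> * g \<zeta>" by blast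
  then show ?case
    by (intro exI[of _ "\<lambda>\<zeta>. h1 \<zeta> + h2 \<zeta>"]) (auto simp: ring_distribs intro: harmonic_poly.add)
qed

lemma harmonic_poly_dense:
  assumes "continuous_on (sphere 0 1) h" "e > 0"
  obtains P where "P holomorphic_on UNIV" "\<And>\<zeta>. norm \<zeta> = 1 \<Longrightarrow> \<bar>h \<zeta> - Re (P \<zeta>)\<bar> < e"
proof -
  \<comment> \<open>Membership only asks for agreement on the circle, because products of harmonic
    polynomials are harmonic polynomials there and not in the plane.\<close>
  define R where "R = {f. \<exists>p. harmonic_poly p \<and> (\<forall>\<zeta>\<in>sphere 0 1. f \<zeta> = p \<zeta>)}"
  interpret function_ring_on R "sphere (0::complex) 1"
  proof
    show "compact (sphere (0::complex) 1)" by simp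
    show "continuous_on (sphere 0 1) f" if "f \<in> R" for f
    proof -
      obtain p where "harmonic_poly p" and eq: "\<forall>\<zeta>\<in>sphere 0 1. f \<zeta> = p \<zeta>"
        using \<open>f \<in> R\<close> R_def by blast
      then obtain P where "P holomorphic_on UNIV" "p = (\<lambda>\<zeta>. Re (P \<zeta>))"
        by (elim harmonic_poly_eq_Re)
      then have "continuous_on (sphere 0 1) p"
        by (auto intro!: continuous_intros holomorphic_on_imp_continuous_on
            intro: holomorphic_on_subset)
      then show ?thesis using eq by (simp cong: continuous_on_cong_simp)
    qed
    show "(\<lambda>x. f x + g x) \<in> R" if asm: "f \<in> R" "g \<in> R" for f g
    proof -
      obtain p q where "harmonic_poly p" "\<forall>\<zeta>\<in>sphere 0 1. f \<zeta> = p \<zeta>"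
        "harmonic_poly q" "\<forall>\<zeta>\<in>sphere 0 1. g \<zeta> = q \<zeta>"
        using asm unfolding R_def by blast
      then show ?thesis using harmonic_poly.add[of p q] unfolding R_def by auto
    qed
    show "(\<lambda>x. f x * g x) \<in> R" if asm: "f \<in> R" "g \<in> R" for f g
    proof -
      obtain p q where "harmonic_poly p" "\<forall>\<zeta>\<in>sphere 0 1. f \<zeta> = p \<zeta>"
        "harmonic_poly q" "\<forall>\<zeta>\<in>sphere 0 1. g \<zeta> = q \<zeta>"
        using asm unfolding R_def by blast
      then show ?thesis using harmonic_poly_mult[of p q] unfolding R_def by auto
    qed
    show "(\<lambda>_. c) \<in> R" for c
      unfolding R_def using harmonic_poly.monom[of "of_real c" 0] by auto
    show "\<exists>f\<in>R. f x \<noteq> f y" if "x \<noteq> y" for x y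
    proof -
      have 1: "Re \<in> R" unfolding R_def using harmonic_poly.monom[of 1 1] by auto
      have "harmonic_poly Im" using harmonic_poly.monom[of "-\<i>" 1] by simp
      then have 2: "Im \<in> R" unfolding R_def by blast
      show ?thesis using that 1 2 complex_eqI by blast
    qed
  qed
  obtain g where "g \<in> R" and g: "\<forall>x\<in>sphere 0 1. \<bar>h x - g x\<bar> < e"
    using Stone_Weierstrass_basic[OF assms] by blast
  then obtain p where "harmonic_poly p" and eq: "\<forall>\<zeta>\<in>sphere 0 1. g \<zeta> = p \<zeta>"
    using R_def by blast
  then obtain P where "P holomorphic_on UNIV" "p = (\<lambda>\<zeta>. Re (P \<zeta>))"
    by (elim harmonic_poly_eq_Re)
  with g eq show thesis by (intro that[of P]) auto
qed

text \<open>Turns an integral inequality into a comparison at the centre: a real part of an entire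
  function lying just above \<open>h\<close> on the circle has its mean as central value, and that
  mean exceeds the mean of \<open>h\<close> by at most \<open>e\<close>.\<close>

lemma sub_mean_value_if_harmonic_majorants:
  assumes cont: "continuous_on (sphere 0 1) h"
    and major: "\<And>P. P holomorphic_on UNIV \<Longrightarrow> (\<And>\<zeta>. norm \<zeta> = 1 \<Longrightarrow> h \<zeta> \<le> Re (P \<zeta>)) \<Longrightarrow> h 0 \<le> Re (P 0)"
  shows "h 0 \<le> circle_mean h"
proof (rule field_le_epsilon)
  fix e :: real assume "e > 0"
  then obtain P where P: "P holomorphic_on UNIV" "\<And>\<zeta>. norm \<zeta> = 1 \<Longrightarrow> \<bar>h \<zeta> - Re (P \<zeta>)\<bar> < e / 2"
    using harmonic_poly_dense[OF cont, of "e / 2"] by auto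
  \<comment> \<open>Raising an e/2-approximation by e/2 makes it a majorant that is still below h +
    e.\<close>
  define Q where "Q = (\<lambda>\<zeta>. P \<zeta> + of_real (e / 2))"
  have hol: "Q holomorphic_on UNIV" unfolding Q_def by (intro holomorphic_intros P)
  have h: "\<bar>h \<zeta> + e / 2 - Re (Q \<zeta>)\<bar> < e / 2" if "norm \<zeta> = 1" for \<zeta>
    using P(2)[OF that] by (simp add: Q_def)
  have contQ: "continuous_on (sphere 0 1) Q"
    by (intro holomorphic_on_imp_continuous_on holomorphic_on_subset[OF hol]) auto
  have "h 0 \<le> Re (Q 0)"
  proof (rule major[OF hol])
    show "h \<zeta> \<le> Re (Q \<zeta>)" if "norm \<zeta> = 1" for \<zeta> using h[OF that] by linarith
  qed
  also have "\<dots> = circle_mean (\<lambda>\<zeta>. Re (Q \<zeta>))"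
    by (rule circle_mean_Re_holomorphic[of _ 2, symmetric]) (auto intro: holomorphic_on_subset[OF hol])
  also have "\<dots> \<le> circle_mean (\<lambda>\<zeta>. h \<zeta> + e)"
  proof (intro circle_mean_mono continuous_intros cont contQ)
    fix \<zeta> :: complex
    show "Re (Q \<zeta>) \<le> h \<zeta> + e" if "norm \<zeta> = 1" using h[OF that] by linarith
  qed
  also have "\<dots> = circle_mean h + e"
    by (subst circle_mean_add) (auto intro: cont)
  finally show "h 0 \<le> circle_mean h + e" .
qed

subsection \<open>Plurisubharmonic functions along holomorphic discs\<close>

lemma vec_holomorphic_little_o:
  fixes G :: "complex \<Rightarrow> complex ^ 'n::finite"
  assumes "\<And>i. (\<lambda>\<zeta>. G \<zeta> $ i) field_differentiable at z" "e > 0"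
  defines "b \<equiv> \<chi> i. deriv (\<lambda>\<zeta>. G \<zeta> $ i) z"
  obtains s where "s > 0" "\<And>h. norm h < s \<Longrightarrow> (norm (G (z + h) - G z - h *s b))\<^sup>2 \<le> e * (norm h)\<^sup>2"
proof -
  \<comment> \<open>The squares of the coordinate errors, each at most (\<kappa> |h|)^2, then add up
    to at most e |h|^2.\<close>
  define \<kappa> where "\<kappa> = sqrt (e / CARD('n))"
  have "\<kappa> > 0" using assms(2) by (simp add: \<kappa>_def)
  have "\<exists>s>0. \<forall>h. norm h < s \<longrightarrow> norm (G (z + h) $ i - G z $ i - h * b $ i) \<le> \<kappa> * norm h" for i
  proof -
    have "((\<lambda>\<zeta>. G \<zeta> $ i) has_derivative (\<lambda>h. b $ i * h)) (at z)"
      using assms(1)[of i] unfolding b_def vec_lambda_beta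
      by (metis field_differentiable_derivI has_field_derivative_def)
    then obtain s where "s > 0" "\<And>y. norm (y - z) < s \<Longrightarrow>
        norm (G y $ i - G z $ i - b $ i * (y - z)) \<le> \<kappa> * norm (y - z)"
      unfolding has_derivative_at_alt using \<open>\<kappa> > 0\<close> by blast
    from \<open>s > 0\<close> this(2)[of "z + h" for h] show ?thesis
      by (intro exI[of _ s]) (auto simp: mult.commute)
  qed
  then obtain s where s: "\<And>i. s i > 0"
    "\<And>i h. norm h < s i \<Longrightarrow> norm (G (z + h) $ i - G z $ i - h * b $ i) \<le> \<kappa> * norm h"
    by metis
  show thesis
  proof (rule that[of "Min (range s)"])
    show "Min (range s) > 0" using s(1) by simp
    fix h :: complex assume "norm h < Min (range s)"
    then have "norm h < s i" for i by simp
    then have "(norm (G (z + h) $ i - G z $ i - h * b $ i))\<^sup>2 \<le> (\<kappa> * norm h)\<^sup>2" for i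
      by (intro power_mono s(2)) auto
    then have "(\<Sum>i\<in>UNIV. (norm (G (z + h) $ i - G z $ i - h * b $ i))\<^sup>2)
        \<le> (\<Sum>i\<in>(UNIV :: 'n set). (\<kappa> * norm h)\<^sup>2)"
      by (intro sum_mono)
    also have "\<dots> = e * (norm h)\<^sup>2"
      using assms(2) by (simp add: power_mult_distrib \<kappa>_def)
    finally show "(norm (G (z + h) - G z - h *s b))\<^sup>2 \<le> e * (norm h)\<^sup>2"
      by (simp add: norm_vec_sq)
  qed
qed

lemma continuous_on_vec_components:
  fixes G :: "'a::topological_space \<Rightarrow> 'b::topological_space ^ 'n::finite"
  assumes "\<And>i. continuous_on S (\<lambda>x. G x $ i)"
  shows "continuous_on S G"
  using continuous_on_vec_lambda[of S "\<lambda>i x. G x $ i"] assms by simp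

lemma continuous_on_scale_vec [continuous_intros]:
  fixes g :: "'a::topological_space \<Rightarrow> complex ^ 'n::finite"
  assumes "continuous_on S f" "continuous_on S g"
  shows "continuous_on S (\<lambda>x. f x *s g x)"
  by (rule continuous_on_vec_components) (auto intro!: continuous_intros assms continuous_on_component)

lemma norm_scale_vec: "norm (c *s (b :: complex ^ 'n::finite)) = norm c * norm b"
  by (simp add: norm_vec_def norm_mult L2_set_right_distrib)

lemma cont_psh_on_circle_mean:
  assumes "cont_psh_on S u" "\<And>\<zeta>. norm \<zeta> \<le> 1 \<Longrightarrow> a + \<zeta> *s b \<in> S"
  shows "u a \<le> circle_mean (\<lambda>\<zeta>. u (a + \<zeta> *s b))"
  using assms unfolding cont_psh_on_def circle_mean_def by auto

text \<open>Plurisubharmonicity is given on affine discs only. The passage to a holomorphic disc \<open>G\<close> is by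
  doubling of variables: maximise $u(w) - N\|w - G(\zeta)\|^2 - \mathrm{Re}\,P(\zeta) + \eta|\zeta|^2$
  over $(\zeta, w)$ and apply the sub-mean value property of \<open>u\<close> at the maximum point on the affine
  disc tangent to \<open>G\<close>. Along it $w - G(\zeta)$ changes by a holomorphic $o(t)$ whose cross term with
  the value at the centre has mean 0, so the mean of the penalty grows by $o(t^2)$ only, less than the
  gain $\eta t^2$.\<close>

theorem cont_psh_on_disc_sub_mean:
  fixes G :: "complex \<Rightarrow> complex ^ 'n::finite"
  assumes op: "open \<Omega>" and psh: "cont_psh_on \<Omega> u"
    and hol: "\<And>i. (\<lambda>\<zeta>. G \<zeta> $ i) holomorphic_on ball 0 R" and R: "R > 1"
    and sub: "G ` ball 0 R \<subseteq> \<Omega>"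
  shows "u (G 0) \<le> circle_mean (\<lambda>\<zeta>. u (G \<zeta>))"
proof -
  have contG: "continuous_on (ball 0 R) G"
    by (intro continuous_on_vec_components holomorphic_on_imp_continuous_on hol)
  have contu: "continuous_on \<Omega> u" using psh by (simp add: cont_psh_on_def)
  have contG1: "continuous_on (cball 0 1) G"
    by (rule continuous_on_subset[OF contG]) (use R in auto)
  define K where "K = G ` cball 0 1"
  have K: "compact K" "K \<noteq> {}" "K \<subseteq> \<Omega>"
    using contG1 R sub by (auto simp: K_def compact_continuous_image)
  \<comment> \<open>\<open>w\<close> will range over \<open>L\<close>, a compact neighbourhood of
    \<open>K\<close> in \<open>\<Omega>\<close>: \<open>u\<close> is bounded and uniformly
    continuous there, and a maximiser close to \<open>K\<close> has room for an affine disc around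
    it.\<close>
  obtain d where d: "d > 0" and L\<Omega>: "{x. infdist x K \<le> d} \<subseteq> \<Omega>"
    using compact_in_open_separated[OF K(2,1) op K(3)] by blast
  define L where "L = {x. infdist x K \<le> d}"
  have compL: "compact L" unfolding L_def by (rule compact_infdist_le[OF K(2,1) d])
  have contL: "continuous_on L u" using contu L\<Omega> L_def continuous_on_subset by blast
  have KL: "K \<subseteq> L" using d by (auto simp: L_def)
  have GK: "G \<zeta> \<in> K" if "norm \<zeta> \<le> 1" for \<zeta> using that by (auto simp: K_def)
  show ?thesis
  proof (rule sub_mean_value_if_harmonic_majorants)
    show "continuous_on (sphere 0 1) (\<lambda>\<zeta>. u (G \<zeta>))"
      by (rule continuous_on_compose2[OF contu continuous_on_subset[OF contG]])
        (use R sub in auto)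
    fix P assume P: "P holomorphic_on UNIV" and le: "\<And>\<zeta>. norm \<zeta> = 1 \<Longrightarrow> u (G \<zeta>) \<le> Re (P \<zeta>)"
    have contP: "continuous_on S P" for S
      by (intro holomorphic_on_imp_continuous_on holomorphic_on_subset[OF P]) auto
    show "u (G 0) \<le> Re (P 0)"
    proof (rule ccontr)
      assume less: "\<not> u (G 0) \<le> Re (P 0)"
      define m where "m = u (G 0) - Re (P 0)"
      have m: "m > 0" using less by (simp add: m_def)
      \<comment> \<open>If the maximiser had |z| = 1, then m would be less than the sum of a third
        for the quadratic term and a third for the oscillation of \<open>u\<close> between
        \<open>w\<close> and \<open>G z\<close>; this forces |z| < 1.\<close>
      define \<eta> where "\<eta> = m / 3"
      have \<eta>: "\<eta> > 0" using m by (simp add: \<eta>_def)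
      obtain \<delta> where \<delta>: "\<delta> > 0" "\<And>x y. x \<in> L \<Longrightarrow> y \<in> L \<Longrightarrow> dist x y < \<delta> \<Longrightarrow> dist (u x) (u y) < m / 3"
        using compact_uniformly_continuous[OF contL compL] m unfolding uniformly_continuous_on_def
        by (metis divide_pos_pos zero_less_numeral)
      obtain B where B: "\<And>x. x \<in> L \<Longrightarrow> \<bar>u x\<bar> \<le> B"
        using compact_imp_bounded[OF compact_continuous_image[OF contL compL]]
        unfolding bounded_iff by auto
      obtain C where "\<forall>x\<in>P ` cball 0 1. norm x \<le> C"
        using compact_imp_bounded[OF compact_continuous_image[OF contP compact_cball[of 0 1]]]
        unfolding bounded_iff by blast
      then have C: "norm (P \<zeta>) \<le> C" if "norm \<zeta> \<le> 1" for \<zeta> using that by simp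
      \<comment> \<open>\<open>\<delta>\<close> makes \<open>u w\<close> and \<open>u (G z)\<close>
        close, \<open>d\<close> leaves a positive margin around \<open>w\<close> in
        \<open>L\<close>. \<open>A\<close> bounds \<open>F\<close> without its penalty and N \<mu>^2
        = A + 1, so a maximiser with |w - G z| at least \<open>\<mu>\<close> would give a negative
        value of \<open>F\<close>.\<close>
      define \<mu> where "\<mu> = min \<delta> d"
      have \<mu>: "\<mu> > 0" using \<delta>(1) d by (simp add: \<mu>_def)
      define A where "A = \<bar>B\<bar> + \<bar>C\<bar> + \<eta>"
      have A: "A > 0" using \<eta> by (simp add: A_def add_nonneg_pos)
      define N where "N = (A + 1) / \<mu>\<^sup>2"
      have N: "N > 0" using A \<mu> by (simp add: N_def)
      define F where "F = (\<lambda>(\<zeta>, w). u w - N * (norm (w - G \<zeta>))\<^sup>2 - Re (P \<zeta>) + \<eta> * (norm \<zeta>)\<^sup>2)"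
      have "continuous_on (cball 0 1 \<times> L) F"
        unfolding F_def case_prod_beta
        by (intro continuous_intros continuous_on_compose2[OF contL]
            continuous_on_compose2[OF contP[of UNIV]] continuous_on_compose2[OF contG1]) auto
      moreover have "cball (0::complex) 1 \<times> L \<noteq> {}" using K(2) KL by auto
      ultimately obtain p where p: "p \<in> cball 0 1 \<times> L" "\<And>q. q \<in> cball 0 1 \<times> L \<Longrightarrow> F q \<le> F p"
        using continuous_attains_sup[OF compact_Times[OF compact_cball compL]] by metis
      obtain z w where zw: "p = (z, w)" by (cases p)
      have z1: "norm z \<le> 1" and wL: "w \<in> L" using p(1) zw by auto
      have Fle: "F (\<zeta>, v) \<le> F (z, w)" if "norm \<zeta> \<le> 1" "v \<in> L" for \<zeta> v
        using p(2)[of "(\<zeta>, v)"] that zw by auto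
      have "m \<le> F (z, w)"
        using Fle[of 0 "G 0"] GK[of 0] KL by (auto simp: F_def m_def)
      then have Fm: "m + N * (norm (w - G z))\<^sup>2 \<le> u w - Re (P z) + \<eta> * (norm z)\<^sup>2"
        by (simp add: F_def)
      have zz: "\<eta> * (norm z)\<^sup>2 \<le> \<eta>"
        using z1 \<eta> by (simp add: power_le_one mult_left_le)
      have near: "norm (w - G z) < \<mu>"
      proof (rule ccontr)
        assume "\<not> norm (w - G z) < \<mu>"
        then have "\<mu>\<^sup>2 \<le> (norm (w - G z))\<^sup>2" using \<mu> by (intro power_mono) auto
        then have "N * \<mu>\<^sup>2 \<le> N * (norm (w - G z))\<^sup>2" using N by simp
        moreover have "N * \<mu>\<^sup>2 = A + 1" using \<mu> by (simp add: N_def)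
        moreover have "\<bar>Re (P z)\<bar> \<le> C" using C[OF z1] abs_Re_le_cmod order_trans by blast
        ultimately show False using Fm zz B[OF wL] m unfolding A_def by linarith
      qed
      have Nnn: "N * (norm (w - G z))\<^sup>2 \<ge> 0" using N by simp
      have z_lt: "norm z < 1"
      proof (rule ccontr)
        assume "\<not> norm z < 1"
        then have "norm z = 1" using z1 by simp
        moreover have "dist (u w) (u (G z)) < m / 3"
          using \<delta>(2)[OF wL, of "G z"] KL GK[OF z1] near by (auto simp: dist_norm \<mu>_def)
        ultimately show False
          using le[of z] Fm zz m Nnn unfolding dist_real_def \<eta>_def by linarith
      qed
      define b where "b = (\<chi> i. deriv (\<lambda>\<zeta>. G \<zeta> $ i) z)"
      have diffG: "(\<lambda>\<zeta>. G \<zeta> $ i) field_differentiable at z" for i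
        using hol[of i] z_lt R by (auto simp: holomorphic_on_open field_differentiable_def)
      \<comment> \<open>After multiplication by \<open>N\<close> this error costs half of the gain
        \<eta> t^2.\<close>
      obtain s where s: "s > 0" "\<And>h. norm h < s \<Longrightarrow>
          (norm (G (z + h) - G z - h *s b))\<^sup>2 \<le> \<eta> / (2 * N) * (norm h)\<^sup>2"
        using vec_holomorphic_little_o[OF diffG, of "\<eta> / (2 * N)"] \<eta> N unfolding b_def by auto
      \<comment> \<open>The three bounds keep the tangent error small, z + \<xi> t in the closed
        unit disc, and w + \<xi> c in \<open>L\<close>. The summand 1 in the denominator covers a
        vanishing tangent vector.\<close>
      define t where "t = min (min (s / 2) (1 - norm z)) ((d - norm (w - G z)) / (norm b + 1))"
      have b1: "norm b + 1 > 0" by (simp add: add_nonneg_pos)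
      have t: "t > 0" "t < s" "norm z + t \<le> 1" "t * norm b \<le> d - norm (w - G z)"
      proof -
        show t0: "t > 0" using s(1) z_lt near b1 by (auto simp: t_def \<mu>_def)
        show "t < s" using s(1) by (auto simp: t_def)
        show "norm z + t \<le> 1" by (auto simp: t_def)
        have "t \<le> (d - norm (w - G z)) / (norm b + 1)" by (simp add: t_def)
        then have "t * (norm b + 1) \<le> d - norm (w - G z)" using b1 by (simp add: field_simps)
        then show "t * norm b \<le> d - norm (w - G z)" using t0 by (simp add: algebra_simps)
      qed
      define c where "c = of_real t *s b"
      have normc: "norm (\<xi> *s c) \<le> t * norm b" if "norm \<xi> \<le> 1" for \<xi>
        using mult_right_mono[OF that, of "t * norm b"] t(1) by (simp add: norm_scale_vec c_def norm_mult mult.assoc)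
      have inL: "w + \<xi> *s c \<in> L" if "norm \<xi> \<le> 1" for \<xi>
      proof -
        have "infdist (w + \<xi> *s c) K \<le> dist (w + \<xi> *s c) (G z)"
          by (rule infdist_le[OF GK[OF z1]])
        also have "\<dots> \<le> norm (w - G z) + norm (\<xi> *s c)"
          unfolding dist_norm by (metis add_diff_eq add.commute norm_triangle_ineq)
        also have "\<dots> \<le> d" using normc[OF that] t(4) by linarith
        finally show ?thesis by (simp add: L_def)
      qed
      \<comment> \<open>The vector inside the penalty along the affine disc: its value at 0 is w - G
        z, and its deviation from that value is the error of the tangent approximation of
        \<open>G\<close> at \<open>z\<close>.\<close>
      define D where "D = (\<lambda>\<xi>. w + \<xi> *s c - G (z + \<xi> * of_real t))"
      \<comment> \<open>The mean value lemmas want holomorphy on a disc of radius greater than 1;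
        |z| + t \<le> 1 and t \<le> 1 yield |z| + R t \<le> R.\<close>
      have in_ball: "z + \<xi> * of_real t \<in> ball 0 R" if "norm \<xi> < R" for \<xi>
      proof -
        have "t \<le> 1" using t(3) norm_ge_zero[of z] by linarith
        have "norm (z + \<xi> * of_real t) \<le> norm z + norm \<xi> * t"
          using t(1) by (metis abs_of_pos norm_mult norm_of_real norm_triangle_ineq)
        also have "\<dots> < norm z + R * t" using that t(1) by simp
        also have "\<dots> \<le> 1 + (R - 1) * t" using t(3) by (simp add: algebra_simps)
        also have "\<dots> \<le> R" using mult_left_mono[OF \<open>t \<le> 1\<close>, of "R - 1"] R by (simp add: algebra_simps)
        finally show ?thesis by simp
      qed
      have cball1: "norm (z + \<xi> * of_real t) \<le> 1" if "norm \<xi> = 1" for \<xi>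
        using t(1,3) that norm_triangle_ineq[of z "\<xi> * of_real t"] by (simp add: norm_mult)
      have holD: "(\<lambda>\<xi>. D \<xi> $ i) holomorphic_on ball 0 R" for i
      proof -
        have "(\<lambda>\<xi>. z + \<xi> * of_real t) ` ball 0 R \<subseteq> ball 0 R"
          using in_ball by (auto simp del: mem_ball simp: mem_ball_0)
        moreover have "(\<lambda>\<xi>. z + \<xi> * of_real t) holomorphic_on ball 0 R"
          by (intro holomorphic_intros)
        ultimately have "(\<lambda>\<xi>. G (z + \<xi> * of_real t) $ i) holomorphic_on ball 0 R"
          using holomorphic_on_compose_gen[OF _ hol[of i]] by (auto simp: o_def)
        then show ?thesis by (auto simp: D_def intro!: holomorphic_intros)
      qed
      have contD: "continuous_on (sphere 0 1) D"
        by (intro continuous_on_vec_components holomorphic_on_imp_continuous_on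
            holomorphic_on_subset[OF holD]) (use R in auto)
      have meanD: "circle_mean (\<lambda>\<xi>. (norm (D \<xi>))\<^sup>2) \<le> (norm (w - G z))\<^sup>2 + \<eta> / (2 * N) * t\<^sup>2"
      proof -
        have "(norm (D \<xi> - D 0))\<^sup>2 \<le> \<eta> / (2 * N) * t\<^sup>2" if "norm \<xi> = 1" for \<xi>
        proof -
          have "(norm (D \<xi> - D 0))\<^sup>2 = (norm (G (z + \<xi> * of_real t) - G z - (\<xi> * of_real t) *s b))\<^sup>2"
            unfolding D_def c_def by (subst norm_minus_commute) (simp add: algebra_simps vector_smult_assoc)
          also have "\<dots> \<le> \<eta> / (2 * N) * (norm (\<xi> * of_real t))\<^sup>2"
            by (rule s(2)) (use that t in \<open>simp add: norm_mult\<close>)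
          finally show ?thesis using that by (simp add: norm_mult)
        qed
        then have "circle_mean (\<lambda>\<xi>. (norm (D \<xi> - D 0))\<^sup>2) \<le> circle_mean (\<lambda>_. \<eta> / (2 * N) * t\<^sup>2)"
          by (intro circle_mean_mono continuous_intros contD)
        then show ?thesis
          unfolding circle_mean_norm_sq[OF holD R] by (simp add: D_def)
      qed
      have mean_sq: "circle_mean (\<lambda>\<xi>. (norm (z + \<xi> * of_real t))\<^sup>2) = (norm z)\<^sup>2 + t\<^sup>2"
      proof -
        have "circle_mean (\<lambda>\<xi>. (norm (\<xi> * of_real t))\<^sup>2) = circle_mean (\<lambda>\<xi>. t\<^sup>2)"
          by (rule circle_mean_cong) (simp add: norm_mult)
        then show ?thesis
          by (subst circle_mean_cnorm_sq[OF _ R]) (auto intro!: holomorphic_intros)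
      qed
      have contP': "continuous_on (sphere 0 1) (\<lambda>\<xi>. P (z + \<xi> * of_real t))"
        by (rule continuous_on_compose2[OF contP[of UNIV]]) (auto intro!: continuous_intros)
      have mean_P: "circle_mean (\<lambda>\<xi>. Re (P (z + \<xi> * of_real t))) = Re (P z)"
      proof -
        have "(\<lambda>\<xi>. z + \<xi> * of_real t) holomorphic_on ball 0 R"
          by (intro holomorphic_intros)
        from holomorphic_on_compose_gen[OF this P]
        have "(\<lambda>\<xi>. P (z + \<xi> * of_real t)) holomorphic_on ball 0 R"
          by (simp add: o_def)
        from circle_mean_Re_holomorphic[OF this R] show ?thesis by simp
      qed
      have "u w \<le> circle_mean (\<lambda>\<xi>. u (w + \<xi> *s c))"
        using inL L\<Omega> by (intro cont_psh_on_circle_mean[OF psh]) (auto simp: L_def)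
      \<comment> \<open>Maximality of (z, w), tested at (z + \<xi> t, w + \<xi> c) and solved for
        \<open>u\<close>.\<close>
      also have "\<dots> \<le> circle_mean (\<lambda>\<xi>. (F (z, w) + N * (norm (D \<xi>))\<^sup>2)
          + (Re (P (z + \<xi> * of_real t)) - \<eta> * (norm (z + \<xi> * of_real t))\<^sup>2))"
      proof (intro circle_mean_mono continuous_intros contD contP')
        show "continuous_on (sphere 0 1) (\<lambda>\<xi>. u (w + \<xi> *s c))"
          by (rule continuous_on_compose2[OF contL]) (auto intro!: continuous_intros inL)
        fix \<xi> :: complex assume "norm \<xi> = 1"
        then show "u (w + \<xi> *s c) \<le> F (z, w) + N * (norm (D \<xi>))\<^sup>2
            + (Re (P (z + \<xi> * of_real t)) - \<eta> * (norm (z + \<xi> * of_real t))\<^sup>2)"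
          using Fle[OF cball1 inL, of \<xi> \<xi>] by (simp add: F_def D_def)
      qed
      also have "\<dots> = (F (z, w) + N * circle_mean (\<lambda>\<xi>. (norm (D \<xi>))\<^sup>2))
          + (Re (P z) - \<eta> * ((norm z)\<^sup>2 + t\<^sup>2))"
        by (simp add: circle_mean_add circle_mean_diff circle_mean_cmult continuous_intros contD contP'
            mean_P mean_sq)
      also have "\<dots> \<le> (F (z, w) + N * ((norm (w - G z))\<^sup>2 + \<eta> / (2 * N) * t\<^sup>2))
          + (Re (P z) - \<eta> * ((norm z)\<^sup>2 + t\<^sup>2))"
        using meanD N by (intro add_mono mult_left_mono) auto
      also have "\<dots> = u w - \<eta> / 2 * t\<^sup>2" using N by (simp add: F_def field_simps)
      finally show False using \<eta> t(1) by (simp add: mult_le_0_iff)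
    qed
  qed
qed

subsection \<open>Functions with a lower bound on the Levi form\<close>

text \<open>The first derivative is required near 0 and the second at 0 alone. This suffices for the
  maximum test, is stable under sums, and applies to a function along a line that leaves its
  domain.\<close>

definition has_second_derivative_0 :: "(real \<Rightarrow> real) \<Rightarrow> real \<Rightarrow> bool" where
  "has_second_derivative_0 f l \<longleftrightarrow>
     (\<exists>f'. (\<forall>\<^sub>F x in nhds 0. (f has_real_derivative f' x) (at x)) \<and> (f' has_real_derivative l) (at 0))"

lemma has_second_derivative_0_add:
  assumes "has_second_derivative_0 f l" "has_second_derivative_0 g m"
  shows "has_second_derivative_0 (\<lambda>x. f x + g x) (l + m)"
proof -
  obtain f' g' where f: "\<forall>\<^sub>F x in nhds 0. (f has_real_derivative f' x) (at x)"
      "(f' has_real_derivative l) (at 0)"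
    and g: "\<forall>\<^sub>F x in nhds 0. (g has_real_derivative g' x) (at x)"
      "(g' has_real_derivative m) (at 0)"
    using assms unfolding has_second_derivative_0_def by blast
  show ?thesis
    unfolding has_second_derivative_0_def
    by (intro exI[of _ "\<lambda>x. f' x + g' x"] conjI DERIV_add f g
        eventually_mono[OF eventually_conj[OF f(1) g(1)]]) (auto intro!: DERIV_add)
qed

lemma has_second_derivative_0_cmult:
  assumes "has_second_derivative_0 f l"
  shows "has_second_derivative_0 (\<lambda>x. c * f x) (c * l)"
proof -
  obtain f' where f: "\<forall>\<^sub>F x in nhds 0. (f has_real_derivative f' x) (at x)"
      "(f' has_real_derivative l) (at 0)"
    using assms unfolding has_second_derivative_0_def by blast
  show ?thesis
    unfolding has_second_derivative_0_def
    by (intro exI[of _ "\<lambda>x. c * f' x"] conjI DERIV_cmult f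
        eventually_mono[OF f(1)]) (auto intro!: DERIV_cmult)
qed

text \<open>At a maximum f' vanishes; if \<open>l\<close> were positive, f' would be positive just
  to the right of 0 and \<open>f\<close> would increase there.\<close>

lemma second_derivative_local_max:
  assumes "has_second_derivative_0 f l" and max: "\<forall>\<^sub>F x in nhds 0. f x \<le> f 0"
  shows "l \<le> 0"
proof (rule ccontr)
  assume "\<not> l \<le> 0"
  obtain f' where f: "\<forall>\<^sub>F x in nhds 0. (f has_real_derivative f' x) (at x)"
      and f': "(f' has_real_derivative l) (at 0)"
    using assms unfolding has_second_derivative_0_def by blast
  obtain d where d: "d > 0" "\<And>x. \<bar>x\<bar> < d \<Longrightarrow> (f has_real_derivative f' x) (at x) \<and> f x \<le> f 0"
    using eventually_conj[OF f max] by (auto simp: eventually_nhds_metric dist_real_def)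
  have "f' 0 = 0"
    using d by (intro DERIV_local_max[of f "f' 0" 0 d]) auto
  moreover obtain e where "e > 0" "\<And>h. 0 < h \<Longrightarrow> h < e \<Longrightarrow> f' 0 < f' (0 + h)"
    using DERIV_pos_inc_right[OF f'] \<open>\<not> l \<le> 0\<close> by auto
  ultimately have e: "e > 0" "\<And>h. 0 < h \<Longrightarrow> h < e \<Longrightarrow> f' h > 0" by auto
  define y where "y = min d e / 2"
  have y: "y > 0" "y < d" "y < e" using d(1) e(1) by (auto simp: y_def)
  have "f 0 < f y"
  proof (rule DERIV_pos_imp_increasing_open[OF y(1)])
    show "\<exists>D. (f has_real_derivative D) (at x) \<and> D > 0" if "0 < x" "x < y" for x
      using d(2)[of x] e(2)[of x] that y by auto
    show "continuous_on {0..y} f"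
      using d(2) y by (intro continuous_at_imp_continuous_on ballI) (force intro: DERIV_isCont)
  qed
  then show False using d(2)[of y] y by auto
qed

lemma has_second_derivative_0_norm_sq:
  fixes p q :: "'a::real_inner"
  shows "has_second_derivative_0 (\<lambda>x. (norm (p + x *\<^sub>R q))\<^sup>2) (2 * (norm q)\<^sup>2)"
proof -
  have eq: "(\<lambda>x. (norm (p + x *\<^sub>R q))\<^sup>2) = (\<lambda>x. (norm p)\<^sup>2 + 2 * x * (p \<bullet> q) + x\<^sup>2 * (norm q)\<^sup>2)"
    by (rule ext) (simp add: power2_norm_eq_inner inner_add_left inner_add_right inner_commute algebra_simps, simp add: power2_eq_square)
  show ?thesis
    unfolding eq has_second_derivative_0_def
    by (intro exI[of _ "\<lambda>x. 2 * (p \<bullet> q) + 2 * x * (norm q)\<^sup>2"] conjI always_eventually allI)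
      (auto intro!: derivative_eq_intros)
qed

text \<open>Harmonicity in directional form: c^2 is 1 for c = 1 and -1 for c = \<open>\<i>\<close>,
  so the two contributions of \<open>P\<close> to a Laplacian cancel.\<close>

lemma has_second_derivative_0_Re_entire:
  assumes "P holomorphic_on UNIV"
  shows "has_second_derivative_0 (\<lambda>x. Re (P (z + of_real x * c))) (Re (c\<^sup>2 * deriv (deriv P) z))"
proof -
  \<comment> \<open>The factor \<open>k\<close> lets one rule serve twice: with k = 1 for
    \<open>P\<close>, with k = c for its derivative.\<close>
  have d: "((\<lambda>x. Re (k * Q (z + of_real x * c))) has_real_derivative Re (c * (k * deriv Q (z + of_real x * c)))) (at x)"
    if Q: "Q holomorphic_on UNIV" for Q x k
  proof -
    have "(Q has_field_derivative deriv Q (z + of_real x * c)) (at (z + of_real x * c))"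
      using holomorphic_derivI[OF Q] by auto
    then have "((\<lambda>x. Q (z + of_real x * c)) has_vector_derivative (c * deriv Q (z + of_real x * c))) (at x)"
      by (intro field_vector_diff_chain_at[of "\<lambda>x. z + of_real x * c" c x Q, unfolded o_def])
        (auto intro!: derivative_eq_intros)
    then have "((\<lambda>x. k * Q (z + of_real x * c)) has_vector_derivative k * (c * deriv Q (z + of_real x * c))) (at x)"
      by (rule has_vector_derivative_mult_right)
    from bounded_linear.has_vector_derivative[OF bounded_linear_Re this] show ?thesis
      by (simp add: has_real_derivative_iff_has_vector_derivative mult.left_commute)
  qed
  have "((\<lambda>x. Re (c * deriv P (z + of_real x * c))) has_real_derivative Re (c * (c * deriv (deriv P) z))) (at 0)"
    using d[of "deriv P" c 0] assms by (simp add: holomorphic_deriv)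
  moreover have "((\<lambda>x. Re (P (z + of_real x * c))) has_real_derivative Re (c * deriv P (z + of_real x * c))) (at x)" for x
    using d[OF assms, of 1 x] by simp
  ultimately show ?thesis
    unfolding has_second_derivative_0_def power2_eq_square mult.assoc
    by (intro exI[of _ "\<lambda>x. Re (c * deriv P (z + of_real x * c))"] conjI always_eventually allI)
qed

text \<open>Were the comparison to fail by m at 0, adding m/2 |\<zeta>|^2 would keep the function at
  most m/2 on the circle and equal to m at 0. At the resulting interior maximum the two second
  derivatives sum to at least 2m, against the maximum test.\<close>

lemma sub_mean_value_if_laplacian_nonneg:
  assumes cont: "continuous_on (cball 0 1) s"
    and lap: "\<And>z. norm z < 1 \<Longrightarrow> \<exists>l m. has_second_derivative_0 (\<lambda>x. s (z + of_real x * 1)) l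
        \<and> has_second_derivative_0 (\<lambda>x. s (z + of_real x * \<i>)) m \<and> l + m \<ge> 0"
  shows "s 0 \<le> circle_mean s"
proof (rule sub_mean_value_if_harmonic_majorants)
  show "continuous_on (sphere 0 1) s" by (rule continuous_on_subset[OF cont]) auto
  fix P assume P: "P holomorphic_on UNIV" and le: "\<And>\<zeta>. norm \<zeta> = 1 \<Longrightarrow> s \<zeta> \<le> Re (P \<zeta>)"
  show "s 0 \<le> Re (P 0)"
  proof (rule ccontr)
    define m where "m = s 0 - Re (P 0)"
    assume "\<not> s 0 \<le> Re (P 0)"
    then have m: "m > 0" by (simp add: m_def)
    define h where "h = (\<lambda>\<zeta>. s \<zeta> + ((-1) * Re (P \<zeta>) + m / 2 * (norm \<zeta>)\<^sup>2))"
    have contP: "continuous_on (cball 0 1) P"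
      by (intro holomorphic_on_imp_continuous_on holomorphic_on_subset[OF P]) auto
    have "continuous_on (cball 0 1) h" unfolding h_def by (intro continuous_intros cont contP)
    then obtain z where z: "norm z \<le> 1" and max: "\<And>\<zeta>. norm \<zeta> \<le> 1 \<Longrightarrow> h \<zeta> \<le> h z"
      using continuous_attains_sup[of "cball (0::complex) 1" h] by auto
    have "norm z < 1"
    proof (rule ccontr)
      assume "\<not> norm z < 1"
      then have "norm z = 1" using z by simp
      then have "h z \<le> m / 2" using le[of z] by (simp add: h_def)
      then show False using max[of 0] m by (simp add: h_def m_def)
    qed
    have test: "l + ((-1) * Re (c\<^sup>2 * deriv (deriv P) z) + m / 2 * (2 * (norm c)\<^sup>2)) \<le> 0"
      if "has_second_derivative_0 (\<lambda>x. s (z + of_real x * c)) l" for c l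
    proof (rule second_derivative_local_max)
      have "has_second_derivative_0 (\<lambda>x. (norm (z + of_real x * c))\<^sup>2) (2 * (norm c)\<^sup>2)"
        using has_second_derivative_0_norm_sq[of z c] by (simp add: scaleR_conv_of_real)
      then show "has_second_derivative_0 (\<lambda>x. h (z + of_real x * c))
          (l + ((-1) * Re (c\<^sup>2 * deriv (deriv P) z) + m / 2 * (2 * (norm c)\<^sup>2)))"
        unfolding h_def
        by (intro has_second_derivative_0_add has_second_derivative_0_cmult that
            has_second_derivative_0_Re_entire P)
      have "((\<lambda>x. z + of_real x * c) \<longlongrightarrow> z + of_real 0 * c) (nhds (0::real))"
        by (intro tendsto_intros filterlim_ident)
      then have "\<forall>\<^sub>F x in nhds (0::real). z + of_real x * c \<in> ball 0 1"
        using \<open>norm z < 1\<close> by (intro topological_tendstoD) auto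
      then show "\<forall>\<^sub>F x in nhds 0. h (z + of_real x * c) \<le> h (z + of_real 0 * c)"
        by eventually_elim (auto intro: max)
    qed
    from lap[OF \<open>norm z < 1\<close>] test[of 1] test[of \<i>] m show False
      by fastforce
  qed
qed

section \<open>The Levi form as a Laplacian along complex lines\<close>

abbreviation second_derivative ::
    "(complex ^ 'n::finite \<Rightarrow> real) \<Rightarrow> complex ^ 'n \<Rightarrow> complex ^ 'n \<Rightarrow> complex ^ 'n \<Rightarrow> real" where
  "second_derivative \<phi> z v w \<equiv> frechet_derivative (\<lambda>x. frechet_derivative \<phi> (at x) v) (at z) w"

lemma C2_has_derivatives:
  fixes \<phi> :: "complex ^ 'n::finite \<Rightarrow> real"
  assumes "open U" "Ck_on 2 U \<phi>" "z \<in> U"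
  shows "(\<phi> has_derivative frechet_derivative \<phi> (at z)) (at z)"
    and "((\<lambda>x. frechet_derivative \<phi> (at x) v) has_derivative second_derivative \<phi> z v) (at z)"
  using assms by (auto simp: numeral_2_eq_2 differentiable_on_eq_differentiable_at frechet_derivative_works)

lemma C2_directional_second_derivative:
  fixes \<phi> :: "complex ^ 'n::finite \<Rightarrow> real"
  assumes "open U" "Ck_on 2 U \<phi>" "z \<in> U"
  shows "has_second_derivative_0 (\<lambda>x. \<phi> (z + x *\<^sub>R v)) (second_derivative \<phi> z v v)"
proof -
  have line: "((\<lambda>x. F (z + x *\<^sub>R v)) has_real_derivative F' v) (at x)"
    if "(F has_derivative F') (at (z + x *\<^sub>R v))" for F :: "complex ^ 'n \<Rightarrow> real" and F' and x :: real
  proof -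
    have "((\<lambda>x. F (z + x *\<^sub>R v)) has_derivative (\<lambda>h. F' (h *\<^sub>R v))) (at x)"
      by (rule has_derivative_compose[where f = "\<lambda>x. z + x *\<^sub>R v" and g = F, OF _ that]) (auto intro!: derivative_eq_intros)
    moreover have "F' (h *\<^sub>R v) = F' v * h" for h
      using linear_scale[OF has_derivative_linear[OF that], of h v] by (simp add: mult.commute)
    ultimately show ?thesis by (simp add: has_field_derivative_def)
  qed
  have "((\<lambda>x. z + x *\<^sub>R v) \<longlongrightarrow> z + 0 *\<^sub>R v) (nhds (0::real))"
    by (intro tendsto_intros filterlim_ident)
  then have "\<forall>\<^sub>F x in nhds (0::real). z + x *\<^sub>R v \<in> U"
    using assms by (intro topological_tendstoD) auto
  then have "\<forall>\<^sub>F x in nhds 0. ((\<lambda>x. \<phi> (z + x *\<^sub>R v)) has_real_derivative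
      frechet_derivative \<phi> (at (z + x *\<^sub>R v)) v) (at x)"
    by eventually_elim (intro line[OF C2_has_derivatives(1)[OF assms(1,2)]])
  moreover have "((\<lambda>x. frechet_derivative \<phi> (at (z + x *\<^sub>R v)) v) has_real_derivative
      second_derivative \<phi> z v v) (at 0)"
    using C2_has_derivatives(2)[OF assms] by (intro line) simp
  ultimately show ?thesis
    unfolding has_second_derivative_0_def
    by (intro exI[of _ "\<lambda>x. frechet_derivative \<phi> (at (z + x *\<^sub>R v)) v"] conjI)
qed

lemma second_derivative_sum:
  fixes \<phi> :: "complex ^ 'n::finite \<Rightarrow> real"
  assumes "open U" "Ck_on 2 U \<phi>" "z \<in> U" "finite I"
  shows "second_derivative \<phi> z (\<Sum>i\<in>I. c i *\<^sub>R v i) (\<Sum>i\<in>I. c i *\<^sub>R v i)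
    = (\<Sum>i\<in>I. \<Sum>j\<in>I. c i * c j * second_derivative \<phi> z (v j) (v i))"
proof -
  let ?s = "\<Sum>i\<in>I. c i *\<^sub>R v i"
  have lin: "linear (frechet_derivative \<phi> (at x))" if "x \<in> U" for x
    using C2_has_derivatives(1)[OF assms(1,2) that] by (rule has_derivative_linear)
  have lin2: "linear (second_derivative \<phi> z w)" for w
    using C2_has_derivatives(2)[OF assms(1-3)] by (rule has_derivative_linear)
  have "((\<lambda>x. \<Sum>j\<in>I. c j * frechet_derivative \<phi> (at x) (v j)) has_derivative
      (\<lambda>h. \<Sum>j\<in>I. c j * second_derivative \<phi> z (v j) h)) (at z)"
    by (intro has_derivative_sum has_derivative_mult_right C2_has_derivatives(2)[OF assms(1-3)])
  \<comment> \<open>Linearity in the first direction is used at all points near \<open>z\<close>,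
    since the result is differentiated once more.\<close>
  then have "((\<lambda>x. frechet_derivative \<phi> (at x) ?s) has_derivative
      (\<lambda>h. \<Sum>j\<in>I. c j * second_derivative \<phi> z (v j) h)) (at z)"
    by (rule has_derivative_transform_within_open[OF _ assms(1,3)])
      (simp add: linear_sum[OF lin] linear_scale[OF lin])
  then have "second_derivative \<phi> z ?s = (\<lambda>h. \<Sum>j\<in>I. c j * second_derivative \<phi> z (v j) h)"
    by (rule frechet_derivative_at[symmetric])
  then show ?thesis
    by (simp add: linear_sum[OF lin2] linear_scale[OF lin2] sum_distrib_left)
      (subst sum.swap, simp add: ac_simps)
qed

lemma complex_hessian_eq_second_derivative:
  fixes \<phi> :: "complex ^ 'n::finite \<Rightarrow> real"
  assumes "open U" "Ck_on 2 U \<phi>" "z \<in> U"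
  shows "complex_hessian \<phi> z $ j $ k =
    (Complex (second_derivative \<phi> z (axis k 1) (axis j 1) + second_derivative \<phi> z (axis k \<i>) (axis j \<i>))
      (second_derivative \<phi> z (axis k \<i>) (axis j 1) - second_derivative \<phi> z (axis k 1) (axis j \<i>))) / 4"
proof -
  let ?F = "\<lambda>w. complex_of_real (\<phi> w)"
  let ?D = "\<lambda>v x. frechet_derivative \<phi> (at x) v"
  have fr: "frechet_derivative ?F (at x) = (\<lambda>h. of_real (?D h x))" if "x \<in> U" for x
    by (rule frechet_derivative_at[symmetric,
        OF has_derivative_of_real[OF C2_has_derivatives(1)[OF assms(1,2) that]]])
  have "((\<lambda>x. (of_real (?D (axis k 1) x) + \<i> * of_real (?D (axis k \<i>) x)) / 2 :: complex) has_derivative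
      (\<lambda>h. (of_real (second_derivative \<phi> z (axis k 1) h) + \<i> * of_real (second_derivative \<phi> z (axis k \<i>) h)) / 2)) (at z)"
    by (intro bounded_linear.has_derivative[OF bounded_linear_divide] has_derivative_add has_derivative_mult_right has_derivative_of_real
        C2_has_derivatives(2)[OF assms])
  then have "(dzbar k ?F has_derivative
      (\<lambda>h. (of_real (second_derivative \<phi> z (axis k 1) h) + \<i> * of_real (second_derivative \<phi> z (axis k \<i>) h)) / 2)) (at z)"
    by (rule has_derivative_transform_within_open[OF _ assms(1,3)]) (simp add: dzbar_def fr)
  then have "frechet_derivative (dzbar k ?F) (at z) =
      (\<lambda>h. (of_real (second_derivative \<phi> z (axis k 1) h) + \<i> * of_real (second_derivative \<phi> z (axis k \<i>) h)) / 2)"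
    by (rule frechet_derivative_at[symmetric])
  then show ?thesis
    by (simp add: complex_hessian_def dz_def complex_eq_iff field_simps)
qed

text \<open>The right-hand side is the Laplacian at 0 of \<phi>(z + \<zeta> b) in \<zeta>, which is
  four times the Levi form. Both sides are expanded in real coordinates and compared for each pair
  (j, k), in the order of differentiation used by \<open>complex_hessian\<close>.\<close>

lemma Re_levi_form_eq:
  fixes \<phi> :: "complex ^ 'n::finite \<Rightarrow> real"
  assumes "open U" "Ck_on 2 U \<phi>" "z \<in> U"
  shows "4 * Re (levi_form \<phi> z b) = second_derivative \<phi> z b b + second_derivative \<phi> z (\<i> *s b) (\<i> *s b)"
proof -
  define S where "S = (\<lambda>j k (c::complex) (d::complex). second_derivative \<phi> z (axis k d) (axis j c))"
  define \<alpha> where "\<alpha> = (\<lambda>j. Re (b $ j))"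
  define \<beta> where "\<beta> = (\<lambda>j. Im (b $ j))"
  have quad: "second_derivative \<phi> z w w = (\<Sum>j\<in>UNIV. \<Sum>k\<in>UNIV.
      x j * x k * S j k 1 1 + x j * y k * S j k 1 \<i> + y j * x k * S j k \<i> 1 + y j * y k * S j k \<i> \<i>)"
    if w: "w = (\<chi> j. Complex (x j) (y j))" for w x y
  proof -
    \<comment> \<open>The real basis of complex space: \<open>True\<close> marks the real and
      \<open>False\<close> the imaginary direction of a coordinate.\<close>
    define v :: "'n \<times> bool \<Rightarrow> complex ^ 'n" where "v = (\<lambda>(j, t). axis j (if t then 1 else \<i>))"
    define c :: "'n \<times> bool \<Rightarrow> real" where "c = (\<lambda>(j, t). if t then x j else y j)"
    have sumUB: "(\<Sum>p\<in>UNIV. g p) = (\<Sum>j\<in>UNIV. g (j, True) + g (j, False))" for g :: "'n \<times> bool \<Rightarrow> 'b::comm_monoid_add"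
      unfolding UNIV_Times_UNIV[symmetric] sum.cartesian_product[symmetric, of "\<lambda>a b. g (a, b)", simplified]
      by (simp add: UNIV_bool add.commute)
    have "w = (\<Sum>p\<in>UNIV. c p *\<^sub>R v p)"
      unfolding sumUB w
      by (simp add: vec_eq_iff v_def c_def axis_def sum_component if_distrib complex_eq_iff cong: if_cong)
    then have "second_derivative \<phi> z w w
        = (\<Sum>p\<in>UNIV. \<Sum>q\<in>UNIV. c p * c q * second_derivative \<phi> z (v q) (v p))"
      using second_derivative_sum[OF assms finite, where c = c and v = v] by simp
    also have "\<dots> = (\<Sum>j\<in>UNIV. \<Sum>k\<in>UNIV.
      x j * x k * S j k 1 1 + x j * y k * S j k 1 \<i> + y j * x k * S j k \<i> 1 + y j * y k * S j k \<i> \<i>)"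
      unfolding sumUB by (simp add: v_def c_def S_def sum.distrib algebra_simps)
    finally show ?thesis .
  qed
  \<comment> \<open>Multiplication by \<open>\<i>\<close> sends the real coordinates (\<alpha>,
    \<beta>) to (-\<beta>, \<alpha>).\<close>
  have "second_derivative \<phi> z b b + second_derivative \<phi> z (\<i> *s b) (\<i> *s b) =
    (\<Sum>j\<in>UNIV. \<Sum>k\<in>UNIV.
      (\<alpha> j * \<alpha> k * S j k 1 1 + \<alpha> j * \<beta> k * S j k 1 \<i> + \<beta> j * \<alpha> k * S j k \<i> 1 + \<beta> j * \<beta> k * S j k \<i> \<i>)
      + (- \<beta> j * - \<beta> k * S j k 1 1 + - \<beta> j * \<alpha> k * S j k 1 \<i> + \<alpha> j * - \<beta> k * S j k \<i> 1 + \<alpha> j * \<alpha> k * S j k \<i> \<i>))"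
    unfolding sum.distrib[symmetric]
    by (subst quad[of b \<alpha> \<beta>]; (subst quad[of "\<i> *s b" "\<lambda>j. - \<beta> j" \<alpha>])?)
      (auto simp: \<alpha>_def \<beta>_def vec_eq_iff complex_eq_iff sum.distrib)
  also have "\<dots> = (\<Sum>j\<in>UNIV. \<Sum>k\<in>UNIV. 4 * Re (complex_hessian \<phi> z $ j $ k * b $ j * cnj (b $ k)))"
    unfolding complex_hessian_eq_second_derivative[OF assms] S_def[symmetric]
    by (intro sum.cong refl) (simp add: \<alpha>_def \<beta>_def S_def field_simps)
  finally show ?thesis by (simp add: levi_form_def sum_distrib_left)
qed

text \<open>Along a + \<zeta> b the Laplacian of \<open>\<phi>\<close> is four times the Levi form,
  at least 4 \<epsilon> |b|^2, which is exactly the Laplacian of the subtracted term.\<close>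

lemma cont_psh_on_minus_norm_sq:
  assumes U: "open U" "\<Omega> \<subseteq> U" and C2: "Ck_on 2 U \<phi>"
    and levi: "\<And>z v. z \<in> \<Omega> \<Longrightarrow> Re (levi_form \<phi> z v) \<ge> \<epsilon> * (norm v)\<^sup>2"
  shows "cont_psh_on \<Omega> (\<lambda>z. \<phi> z - \<epsilon> * (norm z)\<^sup>2)"
proof -
  have cont: "continuous_on U \<phi>"
    using C2_has_derivatives(1)[OF U(1) C2] has_derivative_continuous
    by (intro continuous_at_imp_continuous_on) blast
  then have cont1: "continuous_on \<Omega> (\<lambda>z. \<phi> z - \<epsilon> * (norm z)\<^sup>2)"
    by (intro continuous_intros continuous_on_subset[OF _ U(2)])
  have "\<phi> a - \<epsilon> * (norm a)\<^sup>2 \<le> circle_mean (\<lambda>\<zeta>. \<phi> (a + \<zeta> *s b) - \<epsilon> * (norm (a + \<zeta> *s b))\<^sup>2)"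
    if disc: "\<forall>\<zeta>\<in>cball 0 1. a + \<zeta> *s b \<in> \<Omega>" for a b
  proof -
    let ?s = "\<lambda>\<zeta>. \<phi> (a + \<zeta> *s b) + (- \<epsilon>) * (norm (a + \<zeta> *s b))\<^sup>2"
    have "?s 0 \<le> circle_mean ?s"
    proof (rule sub_mean_value_if_laplacian_nonneg)
      show "continuous_on (cball 0 1) ?s"
        by (intro continuous_intros continuous_on_compose2[OF cont]) (use disc U in auto)
      fix z :: complex assume "norm z < 1"
      then have z: "a + z *s b \<in> \<Omega>" using disc by simp
      have *: "has_second_derivative_0 (\<lambda>x. ?s (z + of_real x * c))
          (second_derivative \<phi> (a + z *s b) (c *s b) (c *s b) + - \<epsilon> * (2 * (norm (c *s b))\<^sup>2))" for c
      proof -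
        have eq: "a + (z + of_real x * c) *s b = (a + z *s b) + x *\<^sub>R (c *s b)" for x
          by (simp add: vec_eq_iff) (simp add: algebra_simps scaleR_conv_of_real)
        show ?thesis unfolding eq
          using z U by (intro has_second_derivative_0_add has_second_derivative_0_cmult
            has_second_derivative_0_norm_sq C2_directional_second_derivative[OF U(1) C2]) auto
      qed
      have "4 * \<epsilon> * (norm b)\<^sup>2 \<le> second_derivative \<phi> (a + z *s b) b b
          + second_derivative \<phi> (a + z *s b) (\<i> *s b) (\<i> *s b)"
        using levi[OF z, of b] z U by (subst Re_levi_form_eq[OF U(1) C2, symmetric]) auto
      moreover have "norm (\<i> *s b) = norm b" by (simp add: norm_vec_def norm_mult)
      ultimately show "\<exists>l m. has_second_derivative_0 (\<lambda>x. ?s (z + of_real x * 1)) l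
        \<and> has_second_derivative_0 (\<lambda>x. ?s (z + of_real x * \<i>)) m \<and> l + m \<ge> 0"
        using *[of 1] *[of \<i>]
        by (intro exI[of _ "second_derivative \<phi> (a + z *s b) b b + - \<epsilon> * (2 * (norm b)\<^sup>2)"]
            exI[of _ "second_derivative \<phi> (a + z *s b) (\<i> *s b) (\<i> *s b) + - \<epsilon> * (2 * (norm (\<i> *s b))\<^sup>2)"] conjI)
          auto
    qed
    then show ?thesis by simp
  qed
  with cont1 show ?thesis unfolding cont_psh_on_def circle_mean_def by blast
qed

subsection \<open>The maximum principle and derivatives of discs\<close>

lemma circle_mean_line_norm_sq:
  fixes a b :: "complex ^ 'n::finite"
  shows "circle_mean (\<lambda>\<zeta>. (norm (a + \<zeta> *s b))\<^sup>2) = (norm a)\<^sup>2 + (norm b)\<^sup>2"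
proof -
  have "circle_mean (\<lambda>\<zeta>. (norm (\<zeta> *s b))\<^sup>2) = circle_mean (\<lambda>_. (norm b)\<^sup>2)"
    by (rule circle_mean_cong) (simp add: norm_scale_vec)
  moreover have "circle_mean (\<lambda>\<zeta>. (norm (a + \<zeta> *s b))\<^sup>2) =
      (norm (a + 0 *s b))\<^sup>2 + circle_mean (\<lambda>\<zeta>. (norm (a + \<zeta> *s b - (a + 0 *s b)))\<^sup>2)"
    by (rule circle_mean_norm_sq[of _ 2]) (auto intro!: holomorphic_intros)
  ultimately show ?thesis by simp
qed

lemma continuous_on_circle_line:
  fixes S :: "(complex ^ 'n::finite) set"
  assumes "continuous_on S u" "\<And>\<zeta>. norm \<zeta> \<le> 1 \<Longrightarrow> a + \<zeta> *s b \<in> S"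
  shows "continuous_on (sphere 0 1) (\<lambda>\<zeta>. u (a + \<zeta> *s b))"
  by (rule continuous_on_compose2[OF assms(1)]) (auto intro!: continuous_intros assms(2))

lemma cont_psh_on_subset: "cont_psh_on S u \<Longrightarrow> T \<subseteq> S \<Longrightarrow> cont_psh_on T u"
  unfolding cont_psh_on_def by (blast intro: continuous_on_subset)

lemma cont_psh_on_add_cmult:
  assumes u: "cont_psh_on S u" and v: "cont_psh_on S v" and c: "c \<ge> 0"
  shows "cont_psh_on S (\<lambda>z. u z + c * v z)"
proof -
  have cont: "continuous_on S u" "continuous_on S v" using u v by (auto simp: cont_psh_on_def)
  have "u a + c * v a \<le> circle_mean (\<lambda>\<zeta>. u (a + \<zeta> *s b) + c * v (a + \<zeta> *s b))"
    if disc: "\<And>\<zeta>. norm \<zeta> \<le> 1 \<Longrightarrow> a + \<zeta> *s b \<in> S" for a b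
  proof -
    have "u a + c * v a \<le> circle_mean (\<lambda>\<zeta>. u (a + \<zeta> *s b)) + c * circle_mean (\<lambda>\<zeta>. v (a + \<zeta> *s b))"
      by (intro add_mono mult_left_mono cont_psh_on_circle_mean[OF u] cont_psh_on_circle_mean[OF v] disc c)
    also have "\<dots> = circle_mean (\<lambda>\<zeta>. u (a + \<zeta> *s b) + c * v (a + \<zeta> *s b))"
      by (simp add: circle_mean_add circle_mean_cmult continuous_intros
          continuous_on_circle_line[OF cont(1) disc] continuous_on_circle_line[OF cont(2) disc])
    finally show ?thesis .
  qed
  then show ?thesis
    unfolding cont_psh_on_def circle_mean_def
    by (auto intro!: continuous_intros cont)
qed

text \<open>Adding a small multiple of the squared norm makes the sub-mean inequality strict, which
  a maximum inside \<open>\<Omega>\<close> contradicts on any small affine disc around it.\<close>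

lemma cont_psh_on_maximum_principle:
  fixes \<Omega> :: "(complex ^ 'n::finite) set"
  assumes \<Omega>: "open \<Omega>" "bounded \<Omega>" and psh: "cont_psh_on \<Omega> \<rho>" and cont: "continuous_on (closure \<Omega>) \<rho>"
    and bdry: "\<And>\<xi>. \<xi> \<in> frontier \<Omega> \<Longrightarrow> \<rho> \<xi> \<le> 0" and z: "z \<in> \<Omega>"
  shows "\<rho> z \<le> 0"
proof (rule ccontr)
  define m where "m = \<rho> z"
  assume "\<not> \<rho> z \<le> 0"
  then have m: "m > 0" by (simp add: m_def)
  obtain B where B: "B > 0" "\<And>x. x \<in> closure \<Omega> \<Longrightarrow> norm x \<le> B"
    using bounded_closure[OF \<Omega>(2)] unfolding bounded_pos by blast
  \<comment> \<open>The added term is at most m/2 on the closure, so \<open>h\<close> stays at most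
    m/2 on the frontier while its maximum is at least m.\<close>
  define \<eta> where "\<eta> = m / (2 * B\<^sup>2)"
  have \<eta>: "\<eta> > 0" using m B by (simp add: \<eta>_def)
  define h where "h = (\<lambda>x. \<rho> x + \<eta> * (norm x)\<^sup>2)"
  have comp: "compact (closure \<Omega>)" using \<Omega> by (simp add: compact_closure)
  have conth: "continuous_on (closure \<Omega>) h" unfolding h_def by (intro continuous_intros cont)
  have zc: "z \<in> closure \<Omega>" using z closure_subset by blast
  then obtain x where x: "x \<in> closure \<Omega>" and max: "\<And>y. y \<in> closure \<Omega> \<Longrightarrow> h y \<le> h x"
    using continuous_attains_sup[OF comp _ conth] by (metis empty_iff)
  have "m \<le> h x" using max[OF zc] \<eta> unfolding h_def m_def
    by (meson add_increasing2 less_imp_le mult_nonneg_nonneg order_trans order_refl zero_le_power2)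
  have "x \<notin> frontier \<Omega>"
  proof
    assume "x \<in> frontier \<Omega>"
    moreover have "\<eta> * (norm x)\<^sup>2 \<le> \<eta> * B\<^sup>2"
      using B(2)[OF x] \<eta> by (intro mult_left_mono power_mono) auto
    moreover have "\<eta> * B\<^sup>2 = m / 2" using B by (simp add: \<eta>_def)
    ultimately show False using bdry \<open>m \<le> h x\<close> m unfolding h_def by force
  qed
  then have "x \<in> \<Omega>" using x \<Omega> by (simp add: frontier_def interior_open)
  then obtain e where e: "e > 0" "cball x e \<subseteq> \<Omega>" using \<Omega>(1) open_contains_cball by blast
  \<comment> \<open>Any coordinate direction will do; \<open>undefined\<close> merely picks
    one.\<close>
  define b :: "complex ^ 'n" where "b = axis undefined (of_real e)"
  have normb: "norm b = e" using e(1) by (simp add: b_def norm_vec_def L2_set_def axis_def if_distrib[of norm] if_distrib[of "\<lambda>t. t\<^sup>2"] cong: if_cong)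
  have disc: "x + \<zeta> *s b \<in> \<Omega>" if "norm \<zeta> \<le> 1" for \<zeta>
  proof -
    have "dist x (x + \<zeta> *s b) \<le> e"
      using that e(1) by (simp add: dist_norm norm_scale_vec normb mult_left_le_one_le)
    then show ?thesis using e(2) by auto
  qed
  have "\<rho> x \<le> circle_mean (\<lambda>\<zeta>. \<rho> (x + \<zeta> *s b))"
    by (rule cont_psh_on_circle_mean[OF psh disc])
  also have "\<dots> \<le> circle_mean (\<lambda>\<zeta>. h x - \<eta> * (norm (x + \<zeta> *s b))\<^sup>2)"
  proof (rule circle_mean_mono)
    show "continuous_on (sphere 0 1) (\<lambda>\<zeta>. \<rho> (x + \<zeta> *s b))"
      using psh disc by (intro continuous_on_circle_line[of \<Omega>]) (auto simp: cont_psh_on_def)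
    fix \<zeta> :: complex assume "norm \<zeta> = 1"
    then have "x + \<zeta> *s b \<in> closure \<Omega>" using disc[of \<zeta>] closure_subset by auto
    from max[OF this] show "\<rho> (x + \<zeta> *s b) \<le> h x - \<eta> * (norm (x + \<zeta> *s b))\<^sup>2"
      unfolding h_def by linarith
  qed (intro continuous_intros)
  also have "\<dots> = h x - \<eta> * ((norm x)\<^sup>2 + e\<^sup>2)"
    by (simp add: circle_mean_diff circle_mean_cmult circle_mean_line_norm_sq normb continuous_intros)
  also have "\<dots> = \<rho> x - \<eta> * e\<^sup>2" by (simp add: h_def algebra_simps)
  finally show False using \<eta> e by (simp add: mult_le_0_iff)
qed

section \<open>Bounding the derivative of a disc at its centre\<close>

lemma circle_mean_norm_sq_ge_deriv:
  assumes "f holomorphic_on ball 0 R" "R > 1"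
  shows "(norm (deriv f 0))\<^sup>2 \<le> circle_mean (\<lambda>\<zeta>. (norm (f \<zeta> - f 0))\<^sup>2)"
proof -
  \<comment> \<open>The difference quotient extends holomorphically with value f'(0) at 0 and has
    the modulus of f - f(0) on the unit circle, so |f'(0)|^2 is at most the mean.\<close>
  define k where "k = (\<lambda>\<zeta>. if \<zeta> = 0 then deriv f 0 else (f \<zeta> - f 0) / (\<zeta> - 0))"
  have k: "k holomorphic_on ball 0 R" unfolding k_def by (rule pole_lemma_open[OF assms(1) open_ball])
  have contk: "continuous_on (sphere 0 1) k"
    by (intro holomorphic_on_imp_continuous_on holomorphic_on_subset[OF k]) (use assms in auto)
  have "circle_mean (\<lambda>_. 0) \<le> circle_mean (\<lambda>\<zeta>. (norm (k \<zeta> - k 0))\<^sup>2)"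
    by (intro circle_mean_mono continuous_intros contk) auto
  then have "(norm (k 0))\<^sup>2 \<le> circle_mean (\<lambda>\<zeta>. (norm (k \<zeta>))\<^sup>2)"
    unfolding circle_mean_cnorm_sq[OF k assms(2)] by simp
  also have "\<dots> = circle_mean (\<lambda>\<zeta>. (norm (f \<zeta> - f 0))\<^sup>2)"
    by (rule circle_mean_cong) (auto simp: k_def norm_divide)
  finally show ?thesis by (simp add: k_def)
qed

lemma circle_mean_norm_sq_ge_derivative:
  fixes G :: "complex \<Rightarrow> complex ^ 'n::finite"
  assumes hol: "\<And>i. (\<lambda>\<zeta>. G \<zeta> $ i) holomorphic_on ball 0 R" and R: "R > 1"
  shows "(norm (G 0))\<^sup>2 + (norm (\<chi> i. deriv (\<lambda>\<zeta>. G \<zeta> $ i) 0))\<^sup>2 \<le> circle_mean (\<lambda>\<zeta>. (norm (G \<zeta>))\<^sup>2)"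
proof -
  have cont: "continuous_on (sphere 0 1) (\<lambda>\<zeta>. G \<zeta> $ i)" for i
    by (intro holomorphic_on_imp_continuous_on holomorphic_on_subset[OF hol]) (use R in auto)
  have "(norm (\<chi> i. deriv (\<lambda>\<zeta>. G \<zeta> $ i) 0))\<^sup>2 \<le> (\<Sum>i\<in>UNIV. circle_mean (\<lambda>\<zeta>. (norm (G \<zeta> $ i - G 0 $ i))\<^sup>2))"
    unfolding norm_vec_sq by (auto intro!: sum_mono circle_mean_norm_sq_ge_deriv[OF hol R])
  also have "\<dots> = circle_mean (\<lambda>\<zeta>. (norm (G \<zeta> - G 0))\<^sup>2)"
    unfolding norm_vec_sq by (subst circle_mean_sum) (auto intro!: continuous_intros cont)
  finally show ?thesis unfolding circle_mean_norm_sq[OF hol R] by simp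
qed

lemma disc_derivative_bound:
  fixes g :: "complex \<Rightarrow> complex ^ 'n::finite"
  assumes op: "open \<Omega>" and psh: "cont_psh_on \<Omega> (\<lambda>z. \<rho> z - \<kappa> * (norm z)\<^sup>2)" and \<kappa>: "\<kappa> \<ge> 0"
    and neg: "\<And>z. z \<in> \<Omega> \<Longrightarrow> \<rho> z \<le> 0"
    and hol: "\<And>i. (\<lambda>\<zeta>. g \<zeta> $ i) holomorphic_on ball 0 1" and sub: "g ` ball 0 1 \<subseteq> \<Omega>"
  shows "\<kappa> * (norm (\<chi> i. deriv (\<lambda>\<zeta>. g \<zeta> $ i) 0))\<^sup>2 \<le> - \<rho> (g 0)"
proof (rule field_le_mult_one_interval)
  fix q :: real assume q: "0 < q" "q < 1"
  \<comment> \<open>Shrinking makes the disc holomorphic on a radius greater than 1 and scales its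
    derivative by \<open>r\<close>. The derivative enters squared, so the loss is exactly the factor
    \<open>q\<close>.\<close>
  define r where "r = sqrt q"
  have r: "0 < r" "r < 1" "r\<^sup>2 = q" using q by (auto simp: r_def)
  define R where "R = 1 / r"
  have R: "R > 1" using r by (simp add: R_def)
  define G where "G = (\<lambda>\<zeta>. g (of_real r * \<zeta>))"
  have maps: "of_real r * \<zeta> \<in> ball 0 1" if "\<zeta> \<in> ball 0 R" for \<zeta> :: complex
    using that r by (simp add: R_def norm_mult field_simps)
  have holG: "(\<lambda>\<zeta>. G \<zeta> $ i) holomorphic_on ball 0 R" for i
  proof -
    have "(\<lambda>\<zeta>::complex. of_real r * \<zeta>) holomorphic_on ball 0 R" by (intro holomorphic_intros)
    moreover have "(\<lambda>\<zeta>::complex. of_real r * \<zeta>) ` ball 0 R \<subseteq> ball 0 1" using maps by blast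
    ultimately show ?thesis
      using holomorphic_on_compose_gen[OF _ hol[of i]] by (auto simp: o_def G_def)
  qed
  have subG: "G ` ball 0 R \<subseteq> \<Omega>" using maps sub unfolding G_def by blast
  have inG: "G \<zeta> \<in> \<Omega>" if "norm \<zeta> = 1" for \<zeta> using that subG R by auto
  have contG: "continuous_on (sphere 0 1) G"
    by (intro continuous_on_vec_components holomorphic_on_imp_continuous_on
        holomorphic_on_subset[OF holG]) (use R in auto)
  have "deriv (\<lambda>\<zeta>. G \<zeta> $ i) 0 = of_real r * deriv (\<lambda>\<zeta>. g \<zeta> $ i) 0" for i
  proof -
    have "((\<lambda>\<zeta>. g \<zeta> $ i) has_field_derivative deriv (\<lambda>\<zeta>. g \<zeta> $ i) 0) (at (of_real r * 0))"
      using holomorphic_derivI[OF hol[of i] open_ball, of 0] by simp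
    then have "((\<lambda>\<zeta>. g (of_real r * \<zeta>) $ i) has_field_derivative (deriv (\<lambda>\<zeta>. g \<zeta> $ i) 0 * of_real r)) (at 0)"
      by (rule DERIV_chain2) (auto intro!: derivative_eq_intros)
    then show ?thesis unfolding G_def by (simp add: DERIV_imp_deriv mult.commute)
  qed
  then have dG: "(\<chi> i. deriv (\<lambda>\<zeta>. G \<zeta> $ i) 0) = of_real r *s (\<chi> i. deriv (\<lambda>\<zeta>. g \<zeta> $ i) 0)"
    by (simp add: vec_eq_iff)
  have cont: "continuous_on \<Omega> (\<lambda>z. \<rho> z - \<kappa> * (norm z)\<^sup>2)" using psh by (simp add: cont_psh_on_def)
  have "\<rho> (G 0) - \<kappa> * (norm (G 0))\<^sup>2 \<le> circle_mean (\<lambda>\<zeta>. \<rho> (G \<zeta>) - \<kappa> * (norm (G \<zeta>))\<^sup>2)"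
    by (rule cont_psh_on_disc_sub_mean[OF op psh holG R subG])
  also have "\<dots> \<le> circle_mean (\<lambda>\<zeta>. (- \<kappa>) * (norm (G \<zeta>))\<^sup>2)"
  proof (rule circle_mean_mono)
    show "continuous_on (sphere 0 1) (\<lambda>\<zeta>. \<rho> (G \<zeta>) - \<kappa> * (norm (G \<zeta>))\<^sup>2)"
      by (rule continuous_on_compose2[OF cont contG]) (use inG in auto)
  qed (use neg inG in \<open>auto intro!: continuous_intros contG\<close>)
  also have "\<dots> = (- \<kappa>) * circle_mean (\<lambda>\<zeta>. (norm (G \<zeta>))\<^sup>2)" by (rule circle_mean_cmult)
  also have "\<dots> \<le> (- \<kappa>) * ((norm (G 0))\<^sup>2 + (norm (\<chi> i. deriv (\<lambda>\<zeta>. G \<zeta> $ i) 0))\<^sup>2)"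
    using circle_mean_norm_sq_ge_derivative[OF holG R] \<kappa> by (intro mult_left_mono_neg) auto
  also have "\<dots> = - \<kappa> * (norm (G 0))\<^sup>2 - q * (\<kappa> * (norm (\<chi> i. deriv (\<lambda>\<zeta>. g \<zeta> $ i) 0))\<^sup>2)"
    unfolding dG norm_scale_vec using r by (simp add: algebra_simps power_mult_distrib)
  finally show "q * (\<kappa> * (norm (\<chi> i. deriv (\<lambda>\<zeta>. g \<zeta> $ i) 0))\<^sup>2) \<le> - \<rho> (g 0)"
    by (simp add: G_def)
qed

subsection \<open>Boundary estimates and the Kobayashi metric\<close>

text \<open>On a ball inside \<open>\<Omega>\<close> where \<open>u\<close> takes two values, the
  segment between the two points can be cut into about d/r pieces of length at most r. Each piece
  changes \<open>u\<close> by at most \<omega>(r), so \<omega>(r) is at least a multiple of r.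
  Connectedness supplies such a ball; in \<open>\<Omega>\<close> itself the segment could leave the
  domain.\<close>

lemma modulus_of_continuity_lower_bound:
  fixes u :: "'a::real_normed_vector \<Rightarrow> real"
  assumes \<Omega>: "open \<Omega>" "connected \<Omega>" and cont: "continuous_on (closure \<Omega>) u"
    and mod: "modulus_of_continuity_on (closure \<Omega>) u \<omega>" and nc: "\<not> u constant_on closure \<Omega>"
  shows "\<exists>a>0. \<forall>\<^sub>F r in at_right 0. a * r \<le> \<omega> r"
proof -
  have "\<exists>p\<in>\<Omega>. \<exists>R>0. ball p R \<subseteq> \<Omega> \<and> (\<exists>x\<in>ball p R. u x \<noteq> u p)"
  proof (rule ccontr)
    assume *: "\<not> ?thesis"
    have "u constant_on \<Omega>"
    proof (rule locally_constant_imp_constant[OF \<Omega>(2)])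
      fix p assume "p \<in> \<Omega>"
      then obtain R where R: "R > 0" "ball p R \<subseteq> \<Omega>"
        using \<Omega>(1) open_contains_ball by blast
      then have "\<forall>x\<in>ball p R. u x = u p" using * \<open>p \<in> \<Omega>\<close> by blast
      moreover have "openin (top_of_set \<Omega>) (ball p R)" using R by (simp add: \<Omega>(1) openin_open_eq)
      moreover have "p \<in> ball p R" using R by simp
      ultimately show "\<exists>T. openin (top_of_set \<Omega>) T \<and> p \<in> T \<and> (\<forall>x\<in>T. u x = u p)"
        by blast
    qed
    then show False using constant_on_closureI cont nc by blast
  qed
  then obtain p R x where R: "R > 0" "ball p R \<subseteq> \<Omega>" and x: "x \<in> ball p R" "u x \<noteq> u p" by blast
  define d where "d = dist p x"
  define m where "m = \<bar>u x - u p\<bar>"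
  have d: "d > 0" and m: "m > 0" using x by (auto simp: d_def m_def)
  have "m / (2 * d) * r \<le> \<omega> r" if r: "0 < r" "r < d" for r
  proof -
    \<comment> \<open>Rounding up makes each piece at most \<open>r\<close> long, and r < d gives N
      \<le> 2 d / r; hence the constant m / (2 d).\<close>
    define N where "N = nat \<lceil>d / r\<rceil>"
    have "d / r > 0" using d r by simp
    then have N: "N > 0" "d / r \<le> N" "N \<le> d / r + 1"
      unfolding N_def by (auto simp: of_nat_nat)
    define pt where "pt = (\<lambda>k::nat. p + (real k / real N) *\<^sub>R (x - p))"
    have ptin: "pt k \<in> closure \<Omega>" if "k \<le> N" for k
    proof -
      have "real k / real N * d \<le> d"
        using that N(1) d by (simp add: field_simps mult_right_mono)
      moreover have "dist p (pt k) = real k / real N * d"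
        by (simp add: pt_def dist_norm d_def norm_minus_commute)
      ultimately have "pt k \<in> ball p R" using x(1) by (simp add: d_def)
      then show ?thesis using R closure_subset by blast
    qed
    have step: "\<bar>u (pt (Suc k)) - u (pt k)\<bar> \<le> \<omega> r" if "Suc k \<le> N" for k
    proof -
      have "pt (Suc k) - pt k = (1 / real N) *\<^sub>R (x - p)"
        by (simp add: pt_def scaleR_left_diff_distrib[symmetric] diff_divide_distrib[symmetric])
      then have "dist (pt (Suc k)) (pt k) = d / N"
        by (simp add: dist_norm d_def norm_minus_commute)
      moreover have "d / N \<le> r" using N r d by (simp add: field_simps)
      moreover have "\<bar>u (pt (Suc k)) - u (pt k)\<bar> \<le> \<omega> (dist (pt (Suc k)) (pt k))"
        using mod ptin that unfolding modulus_of_continuity_on_def by (simp add: Suc_leD)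
      moreover have "\<omega> (d / N) \<le> \<omega> r"
        using mod \<open>d / N \<le> r\<close> d r unfolding modulus_of_continuity_on_def mono_on_def by simp
      ultimately show ?thesis by simp
    qed
    have "\<bar>u (pt k) - u p\<bar> \<le> k * \<omega> r" if "k \<le> N" for k
      using that
    proof (induction k)
      case 0 then show ?case by (simp add: pt_def)
    next
      case (Suc k) then show ?case using step[of k] by (simp add: algebra_simps)
    qed
    from this[of N] have "m \<le> N * \<omega> r" using N(1) by (simp add: pt_def m_def)
    also have "\<omega> r \<ge> 0" using mod r unfolding modulus_of_continuity_on_def by simp
    then have "N * \<omega> r \<le> (2 * d / r) * \<omega> r"
      using N(3) r by (intro mult_right_mono) (auto simp: field_simps)
    finally show ?thesis using d r by (simp add: field_simps)
  qed
  then show ?thesis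
    using d m by (intro exI[of _ "m / (2 * d)"]) (auto simp: eventually_at_right_field)
qed

text \<open>Past the range of the given bound, monotonicity keeps \<open>\<omega>\<close> above its
  value at b/2, and division by \<open>D\<close> turns this constant into a linear bound up to
  \<open>D\<close>.\<close>

lemma modulus_of_continuity_ge_linear:
  assumes mod: "modulus_of_continuity_on S u \<omega>" and "D > 0" "a > 0" "\<forall>\<^sub>F r in at_right 0. a * r \<le> \<omega> r"
  obtains c where "c > 0" "\<And>r. 0 < r \<Longrightarrow> r \<le> D \<Longrightarrow> c * r \<le> \<omega> r"
proof -
  obtain b where b: "b > 0" "\<And>r. 0 < r \<Longrightarrow> r < b \<Longrightarrow> a * r \<le> \<omega> r"
    using assms(4) by (auto simp: eventually_at_right_field)
  show thesis
  proof (rule that[of "min a (a * (b / 2) / D)"])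
    show "min a (a * (b / 2) / D) > 0" using assms b by simp
    fix r assume r: "0 < r" "r \<le> D"
    show "min a (a * (b / 2) / D) * r \<le> \<omega> r"
    proof (cases "r < b")
      case True
      have "min a (a * (b / 2) / D) * r \<le> a * r" using r by (intro mult_right_mono) auto
      then show ?thesis using b(2)[OF r(1) True] by linarith
    next
      case False
      have "min a (a * (b / 2) / D) * r \<le> (a * (b / 2) / D) * D"
        using r assms b by (intro mult_mono) auto
      also have "\<dots> = a * (b / 2)" using assms by simp
      also have "\<dots> \<le> \<omega> (b / 2)" using b(1) b(2)[of "b / 2"] by simp
      also have "\<dots> \<le> \<omega> r"
        using mod False b(1) r unfolding modulus_of_continuity_on_def mono_on_def by simp
      finally show ?thesis .
    qed
  qed
qed

text \<open>\<open>Ck_on\<close> gives continuity of the derivative direction by direction, so each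
  basis direction is bounded on \<open>K\<close> and the bounds are added.\<close>

lemma C1_onorm_bound:
  fixes \<phi> :: "'a::euclidean_space \<Rightarrow> real"
  assumes "open U" "Ck_on 1 U \<phi>" "compact K" "K \<subseteq> U"
  obtains L where "L \<ge> 0" "\<And>x. x \<in> K \<Longrightarrow> onorm (frechet_derivative \<phi> (at x)) \<le> L"
proof -
  have "\<exists>l. \<forall>x\<in>K. \<bar>frechet_derivative \<phi> (at x) v\<bar> \<le> l" for v
  proof -
    have "continuous_on K (\<lambda>x. frechet_derivative \<phi> (at x) v)"
      using assms(2) by (auto intro: continuous_on_subset[OF _ assms(4)])
    from compact_imp_bounded[OF compact_continuous_image[OF this assms(3)]]
    show ?thesis unfolding bounded_iff by auto
  qed
  then obtain l where l: "\<And>v x. x \<in> K \<Longrightarrow> \<bar>frechet_derivative \<phi> (at x) v\<bar> \<le> l v" by metis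
  define L where "L = (\<Sum>b\<in>Basis. \<bar>l b\<bar>)"
  show thesis
  proof (rule that[of L])
    show "L \<ge> 0" by (simp add: L_def sum_nonneg)
    fix x assume x: "x \<in> K"
    have "(\<phi> has_derivative frechet_derivative \<phi> (at x)) (at x)"
      using assms x by (auto simp: differentiable_on_eq_differentiable_at frechet_derivative_works)
    then have lin: "linear (frechet_derivative \<phi> (at x))" by (rule has_derivative_linear)
    show "onorm (frechet_derivative \<phi> (at x)) \<le> L"
    proof (rule onorm_bound)
      fix h
      have "frechet_derivative \<phi> (at x) h = (\<Sum>b\<in>Basis. (h \<bullet> b) * frechet_derivative \<phi> (at x) b)"
        by (subst euclidean_representation[of h, symmetric])
          (simp add: linear_sum[OF lin] linear_scale[OF lin])
      also have "\<bar>\<dots>\<bar> \<le> (\<Sum>b\<in>Basis. norm h * \<bar>l b\<bar>)"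
        using l[OF x] by (intro order_trans[OF sum_abs] sum_mono)
          (auto simp: abs_mult Basis_le_norm intro!: mult_mono order_trans[OF l[OF x] abs_ge_self])
      finally show "norm (frechet_derivative \<phi> (at x) h) \<le> L * norm h"
        by (simp add: L_def sum_distrib_left mult.commute)
    qed (simp add: L_def sum_nonneg)
  qed
qed

section \<open>From disc derivatives to the metric, and the final estimate\<close>

lemma kobayashi_metric_ge:
  fixes \<Omega> :: "(complex ^ 'n::finite) set"
  assumes op: "open \<Omega>" and z: "z \<in> \<Omega>"
    and bound: "\<And>g. (\<And>i. (\<lambda>\<zeta>. g \<zeta> $ i) holomorphic_on ball 0 1) \<Longrightarrow> g ` ball 0 1 \<subseteq> \<Omega> \<Longrightarrow> g 0 = z \<Longrightarrow>
      b * norm (\<chi> i. deriv (\<lambda>\<zeta>. g \<zeta> $ i) 0) \<le> 1"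
  shows "b * norm v \<le> kobayashi_metric \<Omega> z v"
  unfolding kobayashi_metric_def
proof (rule cInf_greatest)
  \<comment> \<open>A lower bound passes to a real \<open>Inf\<close> only for a non-empty set; a
    small affine disc in direction \<open>v\<close> supplies an element. The summand 1 in
    \<open>s\<close> admits v = 0.\<close>
  obtain e where e: "e > 0" "cball z e \<subseteq> \<Omega>" using op z open_contains_cball by blast
  define s where "s = e / (norm v + 1)"
  have v1: "norm v + 1 > 0" by (simp add: add_nonneg_pos)
  have s: "s > 0" "s * norm v \<le> e" using e v1 by (auto simp: s_def field_simps)
  define g where "g = (\<lambda>\<zeta>. z + \<zeta> *s (of_real s *s v))"
  have "(\<lambda>\<zeta>. g \<zeta> $ i) holomorphic_on ball 0 1" for i
    unfolding g_def by (auto intro!: holomorphic_intros)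
  moreover have "g ` ball 0 1 \<subseteq> \<Omega>"
  proof safe
    fix \<zeta> :: complex assume "\<zeta> \<in> ball 0 1"
    then have "norm \<zeta> * (s * norm v) \<le> 1 * (s * norm v)" using s by (intro mult_right_mono) auto
    moreover have "dist z (g \<zeta>) = norm \<zeta> * (s * norm v)"
      using s(1) by (simp add: g_def dist_norm norm_scale_vec norm_mult)
    ultimately have "dist z (g \<zeta>) \<le> e" using s(2) by linarith
    then show "g \<zeta> \<in> \<Omega>" using e(2) by auto
  qed
  moreover have "g 0 = z" by (simp add: g_def)
  moreover have "deriv (\<lambda>\<zeta>. g \<zeta> $ i) 0 = of_real s * v $ i" for i
    unfolding g_def by (rule DERIV_imp_deriv) (auto intro!: derivative_eq_intros)
  then have "of_real (1 / s) *s (\<chi> i. deriv (\<lambda>\<zeta>. g \<zeta> $ i) 0) = v"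
    using s by (simp add: vec_eq_iff)
  ultimately show "{norm a | a :: complex. \<exists>g :: complex \<Rightarrow> complex ^ 'n.
        (\<forall>i. (\<lambda>\<zeta>. g \<zeta> $ i) holomorphic_on ball 0 1) \<and> g ` ball 0 1 \<subseteq> \<Omega> \<and> g 0 = z \<and>
        a *s (\<chi> i. deriv (\<lambda>\<zeta>. g \<zeta> $ i) 0) = v} \<noteq> {}"
    by blast
next
  fix y assume "y \<in> {norm a | a :: complex. \<exists>g :: complex \<Rightarrow> complex ^ 'n.
        (\<forall>i. (\<lambda>\<zeta>. g \<zeta> $ i) holomorphic_on ball 0 1) \<and> g ` ball 0 1 \<subseteq> \<Omega> \<and> g 0 = z \<and>
        a *s (\<chi> i. deriv (\<lambda>\<zeta>. g \<zeta> $ i) 0) = v}"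
  then obtain a and g :: "complex \<Rightarrow> complex ^ 'n" where y: "y = norm a" and hol: "\<And>i. (\<lambda>\<zeta>. g \<zeta> $ i) holomorphic_on ball 0 1"
    and g: "g ` ball 0 1 \<subseteq> \<Omega>" "g 0 = z" and v: "a *s (\<chi> i. deriv (\<lambda>\<zeta>. g \<zeta> $ i) 0) = v"
    by blast
  have "norm a * (b * norm (\<chi> i. deriv (\<lambda>\<zeta>. g \<zeta> $ i) 0)) \<le> norm a * 1"
    by (intro mult_left_mono bound hol g) auto
  moreover have "b * norm v = norm a * (b * norm (\<chi> i. deriv (\<lambda>\<zeta>. g \<zeta> $ i) 0))"
    unfolding v[symmetric] norm_scale_vec by simp
  ultimately show "b * norm v \<le> y" using y by linarith
qed

text \<open>The closed ball in the closure is what the mean value inequality for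
  \<open>\<phi>\<close> needs: the segment from \<open>z\<close> to the nearest point stays where
  the derivative is bounded, although \<open>\<Omega>\<close> need not be convex.\<close>

lemma frontier_nearest_point:
  fixes \<Omega> :: "'a::euclidean_space set"
  assumes "open \<Omega>" "\<Omega> \<noteq> UNIV" "z \<in> \<Omega>"
  obtains \<xi> where "\<xi> \<in> frontier \<Omega>" "dist z \<xi> = infdist z (frontier \<Omega>)" "dist z \<xi> > 0"
    "cball z (dist z \<xi>) \<subseteq> closure \<Omega>"
proof -
  have "frontier \<Omega> \<noteq> {}" using assms by (auto simp: frontier_eq_empty)
  then obtain \<xi> where \<xi>: "\<xi> \<in> frontier \<Omega>" "infdist z (frontier \<Omega>) = dist z \<xi>"
    using infdist_attains_inf[OF frontier_closed] by blast
  have "z \<notin> frontier \<Omega>" using assms by (simp add: frontier_def interior_open)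
  then have pos: "dist z \<xi> > 0" using \<xi> by auto
  have "ball z (dist z \<xi>) \<subseteq> \<Omega>"
  proof (rule ccontr)
    assume "\<not> ball z (dist z \<xi>) \<subseteq> \<Omega>"
    moreover have "z \<in> ball z (dist z \<xi>) \<inter> \<Omega>" using pos assms(3) by simp
    ultimately have "ball z (dist z \<xi>) \<inter> frontier \<Omega> \<noteq> {}"
      by (intro connected_Int_frontier connected_ball) blast+
    then obtain y where "dist z y < dist z \<xi>" "y \<in> frontier \<Omega>" by auto
    then show False using infdist_le[of y "frontier \<Omega>" z] \<xi>(2) by simp
  qed
  then have "cball z (dist z \<xi>) \<subseteq> closure \<Omega>"
    using closure_mono[of "ball z (dist z \<xi>)" \<Omega>] pos by simp
  with \<xi> pos show thesis using that by simp
qed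

text \<open>The assumption \<open>degenerate\<close> concerns constant \<open>u\<close>, for which
  \<open>\<omega>\<close> may vanish to any order at 0. On the unit disc with \<phi>(z) = |z|^2 and
  f = 0 the solution is constant and \<omega>(r) = r^4 is a modulus of it, but the metric grows only
  like 1/\<delta> and not like 1/\<delta>^2.\<close>

theorem proposition3p4:
  fixes \<Omega> U :: "(complex ^ 'n::finite) set"
    and f \<phi> u :: "complex ^ 'n \<Rightarrow> real"
    and \<omega> :: "real \<Rightarrow> real"
    and \<epsilon> :: real
  assumes "B_regular_domain \<Omega>" and "\<Omega> \<subset> UNIV"
    and "continuous_on (closure \<Omega>) f" and "\<And>z. z \<in> closure \<Omega> \<Longrightarrow> f z \<ge> 0"
    and "open U" and "closure \<Omega> \<subseteq> U"
    and "smooth_on U \<phi>" and "cont_psh_on U \<phi>"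
    and "\<epsilon> > 0"
    and "\<And>z v. z \<in> \<Omega> \<Longrightarrow> Re (levi_form \<phi> z v) \<ge> \<epsilon> * (norm v)\<^sup>2"
    and "solves_dirichlet \<Omega> f (\<lambda>\<xi>. - 2 * \<phi> \<xi>) u"
    and "modulus_of_continuity_on (closure \<Omega>) u \<omega>"
    and degenerate: "u constant_on closure \<Omega> \<Longrightarrow> \<exists>a>0. \<forall>\<^sub>F r in at_right 0. a * r \<le> \<omega> r"
  shows "\<exists>c>0. \<forall>z\<in>\<Omega>. \<forall>v.
           kobayashi_metric \<Omega> z v \<ge> c * sqrt \<epsilon> * (norm v / sqrt (\<omega> (infdist z (frontier \<Omega>))))"
proof -
  have op: "open \<Omega>" and conn: "connected \<Omega>" and bdd: "bounded \<Omega>"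
    using assms(1) by (auto simp: B_regular_domain_def)
  have contu: "continuous_on (closure \<Omega>) u" and pshu: "cont_psh_on \<Omega> u"
    and bdry: "\<And>\<xi>. \<xi> \<in> frontier \<Omega> \<Longrightarrow> u \<xi> = - 2 * \<phi> \<xi>"
    using assms(11) by (auto simp: solves_dirichlet_def)
  have \<Omega>U: "\<Omega> \<subseteq> U" using assms(6) closure_subset by blast
  have C1: "Ck_on 1 U \<phi>" and C2: "Ck_on 2 U \<phi>" using assms(7) by (auto simp: smooth_on_def)
  define \<rho> where "\<rho> = (\<lambda>z. u z + 2 * \<phi> z)"
  have neg: "\<rho> z \<le> 0" if "z \<in> \<Omega>" for z
  proof (rule cont_psh_on_maximum_principle[OF op bdd _ _ _ that])
    show "cont_psh_on \<Omega> \<rho>"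
      unfolding \<rho>_def by (intro cont_psh_on_add_cmult pshu cont_psh_on_subset[OF assms(8) \<Omega>U]) auto
    have "continuous_on (closure \<Omega>) \<phi>"
      using assms(6,8) continuous_on_subset unfolding cont_psh_on_def by blast
    then show "continuous_on (closure \<Omega>) \<rho>" unfolding \<rho>_def by (intro continuous_intros contu)
  qed (simp add: \<rho>_def bdry)
  have "cont_psh_on \<Omega> (\<lambda>z. u z + 2 * (\<phi> z - \<epsilon> * (norm z)\<^sup>2))"
    by (intro cont_psh_on_add_cmult pshu cont_psh_on_minus_norm_sq[OF assms(5) \<Omega>U C2 assms(10)]) auto
  then have psh: "cont_psh_on \<Omega> (\<lambda>z. \<rho> z - 2 * \<epsilon> * (norm z)\<^sup>2)"
    by (simp add: \<rho>_def algebra_simps)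
  obtain B where B: "B > 0" "\<And>x. x \<in> closure \<Omega> \<Longrightarrow> norm x \<le> B"
    using bounded_closure[OF bdd] unfolding bounded_pos by blast
  have "\<exists>a>0. \<forall>\<^sub>F r in at_right 0. a * r \<le> \<omega> r"
    using degenerate modulus_of_continuity_lower_bound[OF op conn contu assms(12)] by blast
  then obtain a0 where a0: "a0 > 0" "\<forall>\<^sub>F r in at_right 0. a0 * r \<le> \<omega> r" by blast
  \<comment> \<open>2B bounds every distance between points of the closure, hence every distance to
    the frontier that occurs.\<close>
  have "2 * B > 0" using B(1) by simp
  from modulus_of_continuity_ge_linear[OF assms(12) this a0]
  obtain a where a: "a > 0" "\<And>r. 0 < r \<Longrightarrow> r \<le> 2 * B \<Longrightarrow> a * r \<le> \<omega> r" by blast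
  have "compact (closure \<Omega>)" using bdd by (simp add: compact_closure)
  from C1_onorm_bound[OF assms(5) C1 this assms(6)]
  obtain L where L: "L \<ge> 0" "\<And>x. x \<in> closure \<Omega> \<Longrightarrow> onorm (frechet_derivative \<phi> (at x)) \<le> L"
    by blast
  \<comment> \<open>Replacing \<delta> by \<omega>(\<delta>)/a in \<omega>(\<delta>) + 2 L \<delta>
    produces this factor.\<close>
  define C where "C = 1 + 2 * L / a"
  have C: "C > 0" using L a by (simp add: C_def add_pos_nonneg)
  have est: "\<omega> (infdist z (frontier \<Omega>)) > 0 \<and> - \<rho> z \<le> C * \<omega> (infdist z (frontier \<Omega>))" if z: "z \<in> \<Omega>" for z
  proof -
    obtain \<xi> where \<xi>: "\<xi> \<in> frontier \<Omega>" "dist z \<xi> = infdist z (frontier \<Omega>)" "dist z \<xi> > 0"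
      "cball z (dist z \<xi>) \<subseteq> closure \<Omega>"
      using frontier_nearest_point[OF op _ z] assms(2) by blast
    define \<delta> where "\<delta> = dist z \<xi>"
    have zc: "z \<in> closure \<Omega>" and \<xi>c: "\<xi> \<in> closure \<Omega>"
      using z \<xi>(1) closure_subset by (auto simp: frontier_def)
    have "\<delta> \<le> 2 * B"
      using B(2)[OF zc] B(2)[OF \<xi>c] norm_triangle_ineq4[of z \<xi>] by (simp add: \<delta>_def dist_norm)
    then have a\<delta>: "a * \<delta> \<le> \<omega> \<delta>" using a(2) \<xi>(3) by (simp add: \<delta>_def)
    have "norm (\<phi> z - \<phi> \<xi>) \<le> L * norm (z - \<xi>)"
    proof (rule differentiable_bound[OF convex_cball[of z \<delta>]])
      fix x assume "x \<in> cball z \<delta>"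
      then have x: "x \<in> closure \<Omega>" using \<xi>(4) by (auto simp: \<delta>_def)
      show "(\<phi> has_derivative frechet_derivative \<phi> (at x)) (at x within cball z \<delta>)"
        using C2_has_derivatives(1)[OF assms(5) C2] x assms(6) by (blast intro: has_derivative_at_withinI)
      show "onorm (frechet_derivative \<phi> (at x)) \<le> L" by (rule L(2)[OF x])
    qed (auto simp: \<delta>_def)
    moreover have "\<bar>u z - u \<xi>\<bar> \<le> \<omega> \<delta>"
      using assms(12) zc \<xi>c by (simp add: modulus_of_continuity_on_def \<delta>_def)
    moreover have "u \<xi> = - 2 * \<phi> \<xi>" using bdry \<xi>(1) by blast
    ultimately have "- \<rho> z \<le> \<omega> \<delta> + 2 * (L * \<delta>)"
      unfolding \<rho>_def \<delta>_def dist_norm real_norm_def by linarith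
    also have "L * \<delta> \<le> L * (\<omega> \<delta> / a)" using a\<delta> a(1) L(1) by (intro mult_left_mono) (auto simp: field_simps)
    finally have "- \<rho> z \<le> C * \<omega> \<delta>" by (simp add: C_def algebra_simps)
    moreover have "\<omega> \<delta> > 0" using a\<delta> a(1) \<xi>(3) unfolding \<delta>_def
      by (meson less_le_trans mult_pos_pos)
    ultimately show ?thesis using \<xi>(2) by (simp add: \<delta>_def)
  qed
  show ?thesis
  proof (intro exI[of _ "sqrt (2 / C)"] conjI ballI allI)
    show "sqrt (2 / C) > 0" using C by simp
    fix z v assume z: "z \<in> \<Omega>"
    define w where "w = \<omega> (infdist z (frontier \<Omega>))"
    have w: "w > 0" "- \<rho> z \<le> C * w" using est[OF z] by (auto simp: w_def)
    \<comment> \<open>The reciprocal of the largest |g'(0)| allowed by 2 \<epsilon> |g'(0)|^2 \<le>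
      C w; splitting the root yields the constant \<open>sqrt (2 / C)\<close>, independent of
      \<open>z\<close> and \<open>v\<close>.\<close>
    define b where "b = sqrt (2 * \<epsilon> / (C * w))"
    have "b * norm v \<le> kobayashi_metric \<Omega> z v"
    proof (rule kobayashi_metric_ge[OF op z])
      fix g :: "complex \<Rightarrow> complex ^ 'n" assume g: "\<And>i. (\<lambda>\<zeta>. g \<zeta> $ i) holomorphic_on ball 0 1" "g ` ball 0 1 \<subseteq> \<Omega>" "g 0 = z"
      let ?d = "norm (\<chi> i. deriv (\<lambda>\<zeta>. g \<zeta> $ i) 0)"
      have "2 * \<epsilon> * ?d\<^sup>2 \<le> C * w"
        using disc_derivative_bound[OF op psh _ neg g(1,2)] assms(9) g(3) w(2) by simp
      then have "(b * ?d)\<^sup>2 \<le> 1"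
        using C w(1) assms(9) by (simp add: b_def power_mult_distrib field_simps)
      then show "b * ?d \<le> 1" unfolding abs_square_le_1 by linarith
    qed
    moreover have "b * norm v = sqrt (2 / C) * sqrt \<epsilon> * (norm v / sqrt w)"
      using C w(1) by (simp add: b_def real_sqrt_mult real_sqrt_divide)
    ultimately show "kobayashi_metric \<Omega> z v \<ge>
        sqrt (2 / C) * sqrt \<epsilon> * (norm v / sqrt (\<omega> (infdist z (frontier \<Omega>))))"
      by (simp add: w_def)
  qed
qed

end
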